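(* Let $A$ be a real $m\times n$ matrix with $m\ge n>\max(k,2)$ and $\operatorname{rank}(A)=n$, let $A=U\Sigma V^T$ be its SVD with singular values $\sigma_1\ge\cdots\ge\sigma_n$, and let $q\ge0$, $0<k\le\ell<n$ and $0\le p\le\ell-k$ be integers. Let $\Omega$ be a real $n\times\ell$ matrix and partition $V^T\Omega=\begin{pmatrix}\widehat\Omega_1\\ \widehat\Omega_2\end{pmatrix}$, where $\widehat\Omega_1$ is $(\ell-p)\times\ell$ and $\widehat\Omega_2$ is $(n-\ell+p)\times\ell$. Assume that $\widehat\Omega_1$ has full row rank. Then the matrix $B_k$ computed by Basic Subspace Iteration with input $A,k,\ell,q,\Omega$ satisfies, for $j=1,\dots,k$, $$\sigma_j\ \ge\ \sigma_j(B_k)\ \ge\ \frac{\sigma_j}{\sqrt{1+\|\widehat\Omega_2\|_2^2\,\|\widehat\Omega_1^\dagger\|_2^2\left(\dfrac{\sigma_{\ell-p+1}}{\sigma_j}\right)^{4q+2}}} .$$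
   Context: $\|\cdot\|_2$ is the spectral norm, $\sigma_j(X)$ is the $j$-th largest singular value of $X$, $X^\dagger$ is the Moore–Penrose pseudo-inverse. In the SVD, $U$ is $m\times n$ with orthonormal columns, $V$ is $n\times n$ orthogonal and $\Sigma=\mathrm{diag}(\sigma_1,\dots,\sigma_n)$. Basic Subspace Iteration (exact arithmetic): compute $Y=(AA^T)^qA\Omega$; compute a matrix $Q$ whose columns form an orthonormal basis of the column space of $Y$; compute $B=Q^TA$; let $B_k$ be the rank-$k$ truncated SVD of $B$ (keep only the $k$ largest singular values and the corresponding singular vectors); the output rank-$k$ approximation is $QB_k$. *)

theory Defs
  imports Complex_Main "Jordan_Normal_Form.DL_Rank" "Jordan_Normal_Form.Char_Poly"
begin

section \<open>Singular value decomposition\<close>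

text \<open>
  The economy-size SVD \<open>X = U \<Sigma> V\<^sup>T\<close>: with \<open>d = min(rows, columns)\<close>, the factors \<open>U\<close> and \<open>V\<close> have
  \<open>d\<close> orthonormal columns and \<open>\<Sigma> = diag(\<sigma> 1, ..., \<sigma> d)\<close>. For an \<open>m \<times> n\<close> matrix with \<open>m \<ge> n\<close> this makes \<open>U\<close>
  an \<open>m \<times> n\<close> matrix with orthonormal columns and \<open>V\<close> an orthogonal \<open>n \<times> n\<close> matrix. Singular values are
  numbered from 1, whereas matrix indices start at 0; values of \<open>\<sigma>\<close> outside \<open>{1..d}\<close> are irrelevant.
\<close>

definition is_svd :: "real mat \<Rightarrow> real mat \<Rightarrow> (nat \<Rightarrow> real) \<Rightarrow> real mat \<Rightarrow> bool" where
  "is_svd X U \<sigma> V \<longleftrightarrow>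
    (let d = min (dim_row X) (dim_col X) in
      U \<in> carrier_mat (dim_row X) d \<and> U\<^sup>T * U = 1\<^sub>m d \<and>
      V \<in> carrier_mat (dim_col X) d \<and> V\<^sup>T * V = 1\<^sub>m d \<and>
      (\<forall>j\<in>{1..d}. 0 \<le> \<sigma> j) \<and>
      (\<forall>i\<in>{1..d}. \<forall>j\<in>{1..d}. i \<le> j \<longrightarrow> \<sigma> j \<le> \<sigma> i) \<and>
      X = U * mat_diag d (\<lambda>i. \<sigma> (Suc i)) * V\<^sup>T)"

text \<open>\<open>singular_value X j\<close> is the \<open>j\<close>-th largest singular value, for \<open>1 \<le> j \<le> min(rows, columns)\<close>.\<close>

definition singular_value :: "real mat \<Rightarrow> nat \<Rightarrow> real" where
  "singular_value X j = (THE s. \<exists>U \<sigma> V. is_svd X U \<sigma> V \<and> s = \<sigma> j)"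

lemma is_svd_transpose:
  assumes "is_svd X U \<sigma> V"
  shows "is_svd X\<^sup>T V \<sigma> U"
proof -
  define d where "d = min (dim_row X) (dim_col X)"
  define D where "D = mat_diag d (\<lambda>i. \<sigma> (Suc i))"
  from assms have U: "U \<in> carrier_mat (dim_row X) d" and V: "V \<in> carrier_mat (dim_col X) d"
    and UU: "U\<^sup>T * U = 1\<^sub>m d" and VV: "V\<^sup>T * V = 1\<^sub>m d"
    and nonneg: "\<forall>j\<in>{1..d}. 0 \<le> \<sigma> j"
    and antimono: "\<forall>i\<in>{1..d}. \<forall>j\<in>{1..d}. i \<le> j \<longrightarrow> \<sigma> j \<le> \<sigma> i"
    and X: "X = U * D * V\<^sup>T"
    unfolding is_svd_def Let_def d_def D_def by blast+
  have D: "D \<in> carrier_mat d d" and DT: "D\<^sup>T = D"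
    by (auto simp: D_def mat_diag_def intro!: eq_matI)
  have "X\<^sup>T = (U * D * V\<^sup>T)\<^sup>T" using X by metis
  also have "\<dots> = V * (U * D)\<^sup>T" 
    using U V D by (subst transpose_mult[of _ "dim_row X" d _ "dim_col X"]) auto
  also have "\<dots> = V * (D * U\<^sup>T)"
    using U D by (subst transpose_mult[of _ "dim_row X" d _ d]) (auto simp: DT)
  also have "\<dots> = V * D * U\<^sup>T"
    using U V D by (subst assoc_mult_mat[of _ "dim_col X" d _ d _ "dim_row X"]) auto
  finally have XT: "X\<^sup>T = V * D * U\<^sup>T" .
  have d': "min (dim_col X) (dim_row X) = d" by (simp add: d_def min.commute)
  show ?thesis
    unfolding is_svd_def Let_def index_transpose_mat transpose_transpose d' D_def[symmetric]
    by (intro conjI U V UU VV nonneg antimono XT)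
qed

lemma svd_char_poly:
  assumes svd: "is_svd X U \<sigma> V" and le: "dim_col X \<le> dim_row X"
  shows "char_poly (X\<^sup>T * X) = (\<Prod>a\<leftarrow>map (\<lambda>i. (\<sigma> (Suc i))\<^sup>2) [0..<dim_col X]. [:- a, 1:])"
proof -
  define m n where "m = dim_row X" and "n = dim_col X"
  define D where "D = mat_diag n (\<lambda>i. \<sigma> (Suc i))"
  have mn: "min m n = n" using le by (simp add: m_def n_def)
  from svd have U: "U \<in> carrier_mat m n" and V: "V \<in> carrier_mat n n"
    and UU: "U\<^sup>T * U = 1\<^sub>m n" and VV: "V\<^sup>T * V = 1\<^sub>m n" and X: "X = U * D * V\<^sup>T"
    unfolding is_svd_def Let_def D_def m_def[symmetric] n_def[symmetric] mn by blast+
  from is_svd_transpose[OF svd] have XT: "X\<^sup>T = V * D * U\<^sup>T"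
    unfolding is_svd_def Let_def D_def index_transpose_mat m_def[symmetric] n_def[symmetric]
    using mn by (metis min.commute)
  have D: "D \<in> carrier_mat n n" by (simp add: D_def)
  have UT: "U\<^sup>T \<in> carrier_mat n m" and VT: "V\<^sup>T \<in> carrier_mat n n" using U V by auto
  have VV': "V * V\<^sup>T = 1\<^sub>m n" using mat_mult_left_right_inverse[OF VT V VV] .
  have "X\<^sup>T * X = (V * D * U\<^sup>T) * (U * D * V\<^sup>T)" using X XT by metis
  also have "U * D * V\<^sup>T = U * (D * V\<^sup>T)" by (rule assoc_mult_mat[OF U D VT])
  also have "V * D * U\<^sup>T * (U * (D * V\<^sup>T)) = V * D * (U\<^sup>T * (U * (D * V\<^sup>T)))"
    using U V D UT VT by (intro assoc_mult_mat[of _ n n _ m _ n]) auto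
  also have "U\<^sup>T * (U * (D * V\<^sup>T)) = D * V\<^sup>T"
    using assoc_mult_mat[OF UT U, of "D * V\<^sup>T" n] D VT UU by simp
  also have "V * D * (D * V\<^sup>T) = V * (D * D) * V\<^sup>T"
    using V D VT by (simp add: assoc_mult_mat[of _ n n _ n _ n])
  finally have eq: "X\<^sup>T * X = V * (D * D) * V\<^sup>T" .
  have "similar_mat (X\<^sup>T * X) (D * D)"
    by (rule similar_matI[OF _ VV' VV eq]) (use V D VT in \<open>auto simp: n_def\<close>)
  from char_poly_similar[OF this] have "char_poly (X\<^sup>T * X) = char_poly (D * D)" .
  also have DD: "D * D = mat_diag n (\<lambda>i. (\<sigma> (Suc i))\<^sup>2)"
    by (simp add: D_def power2_eq_square)
  have "char_poly (D * D) = (\<Prod>a\<leftarrow>diag_mat (D * D). [:- a, 1:])"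
    by (rule char_poly_upper_triangular[of _ n]) (auto simp: DD, auto simp: mat_diag_def)
  also have "diag_mat (D * D) = map (\<lambda>i. (\<sigma> (Suc i))\<^sup>2) [0..<n]"
    unfolding DD by (auto simp: diag_mat_def mat_diag_def)
  finally show ?thesis by (simp add: n_def)
qed

lemma proots_linear_factors:
  "proots (\<Prod>a\<leftarrow>as. [:- a, 1:]) = mset (as :: real list)"
proof (induction as)
  case (Cons a as)
  have "(\<Prod>a\<leftarrow>as. [:- a, 1:]) \<noteq> 0" by (auto simp: prod_list_zero_iff)
  moreover have "proots [:- a, 1:] = {#a#}"
    by simp
  ultimately show ?case using Cons by (simp add: proots_mult del: mult_pCons_left)
qed simp

lemma svd_unique_aux:
  assumes svd: "is_svd X U \<sigma> V" "is_svd X U' \<sigma>' V'" and le: "dim_col X \<le> dim_row X"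
    and j: "j \<in> {1..dim_col X}"
  shows "\<sigma> j = \<sigma>' j"
proof -
  define n where "n = dim_col X"
  have mn: "min (dim_row X) (dim_col X) = n" using le by (simp add: n_def)
  let ?f = "\<lambda>\<sigma>. map (\<lambda>i. (\<sigma> (Suc i) :: real)\<^sup>2) [0..<n]"
  have "mset (?f \<sigma>) = mset (?f \<sigma>')"
    using svd_char_poly[OF svd(1) le] svd_char_poly[OF svd(2) le]
    by (metis proots_linear_factors n_def)
  hence m: "mset (rev (?f \<sigma>)) = mset (rev (?f \<sigma>'))" by simp
  have nn: "\<forall>j\<in>{1..n}. 0 \<le> s j" and anti: "\<forall>i\<in>{1..n}. \<forall>j\<in>{1..n}. i \<le> j \<longrightarrow> s j \<le> s i" 
    if "is_svd X P s W" for P s W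
    using that unfolding is_svd_def Let_def mn by blast+
  have so: "sorted (rev (?f s))" if "is_svd X P s W" for P s W
    unfolding sorted_rev_iff_nth_mono
    using nn[OF that] anti[OF that] by (auto intro!: power_mono)
  have "rev (?f \<sigma>) = rev (?f \<sigma>')"
    using m so[OF svd(1)] so[OF svd(2)] by (metis properties_for_sort)
  hence "?f \<sigma> = ?f \<sigma>'" by (metis rev_rev_ident)
  hence "\<forall>i\<in>{0..<n}. (\<sigma> (Suc i))\<^sup>2 = (\<sigma>' (Suc i))\<^sup>2" by simp
  moreover have "j - 1 \<in> {0..<n}" "Suc (j - 1) = j" using j by (auto simp: n_def)
  ultimately have "(\<sigma> j)\<^sup>2 = (\<sigma>' j)\<^sup>2" by metis
  thus ?thesis using nn[OF svd(1)] nn[OF svd(2)] j by (simp add: n_def)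
qed

text \<open>The singular values do not depend on the SVD, so \<open>singular_value\<close> is well defined.\<close>

lemma svd_unique:
  assumes svd: "is_svd X U \<sigma> V" "is_svd X U' \<sigma>' V'"
    and j: "j \<in> {1..min (dim_row X) (dim_col X)}"
  shows "\<sigma> j = \<sigma>' j"
proof (cases "dim_col X \<le> dim_row X")
  case True
  with svd_unique_aux[OF svd] j show ?thesis by simp
next
  case False
  with svd_unique_aux[OF svd[THEN is_svd_transpose]] j show ?thesis by simp
qed

lemma singular_value_eq:
  assumes "is_svd X U \<sigma> V" and "j \<in> {1..min (dim_row X) (dim_col X)}"
  shows "singular_value X j = \<sigma> j"
  unfolding singular_value_def
proof (rule the_equality)
  show "\<exists>U' \<tau> V'. is_svd X U' \<tau> V' \<and> \<sigma> j = \<tau> j" using assms(1) by blast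
next
  fix s assume "\<exists>U' \<tau> V'. is_svd X U' \<tau> V' \<and> s = \<tau> j"
  then show "s = \<sigma> j" using svd_unique[OF assms(1) _ assms(2)] by metis
qed

text \<open>
  The truncation \<open>U\<^sub>k \<Sigma>\<^sub>k V\<^sub>k\<^sup>T\<close> of an SVD. This is a relation, since the result depends on the chosen
  SVD when the \<open>k\<close>-th and \<open>(k+1)\<close>-st singular values coincide.
\<close>

definition is_truncated_svd :: "nat \<Rightarrow> real mat \<Rightarrow> real mat \<Rightarrow> bool" where
  "is_truncated_svd k X Xk \<longleftrightarrow>
    (\<exists>U \<sigma> V. is_svd X U \<sigma> V \<and>
      Xk = mat_of_cols (dim_row X) (take k (cols U)) *
           mat_diag (min k (min (dim_row X) (dim_col X))) (\<lambda>i. \<sigma> (Suc i)) *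
           (mat_of_cols (dim_col X) (take k (cols V)))\<^sup>T)"

section \<open>Spectral norm and pseudo-inverse\<close>

definition vec_norm2 :: "real vec \<Rightarrow> real" where
  "vec_norm2 v = sqrt (v \<bullet> v)"

definition spectral_norm :: "real mat \<Rightarrow> real" where
  "spectral_norm X = (SUP v\<in>{v \<in> carrier_vec (dim_col X). vec_norm2 v \<le> 1}. vec_norm2 (X *\<^sub>v v))"

definition is_pseudo_inverse :: "real mat \<Rightarrow> real mat \<Rightarrow> bool" where
  "is_pseudo_inverse X P \<longleftrightarrow>
    P \<in> carrier_mat (dim_col X) (dim_row X) \<and>
    X * P * X = X \<and> P * X * P = P \<and> (X * P)\<^sup>T = X * P \<and> (P * X)\<^sup>T = P * X"

definition pseudo_inverse :: "real mat \<Rightarrow> real mat" where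
  "pseudo_inverse X = (THE P. is_pseudo_inverse X P)"

lemma pseudo_inverse_unique:
  assumes "is_pseudo_inverse X P" and "is_pseudo_inverse X R"
  shows "P = R"
proof -
  define m n where "m = dim_row X" and "n = dim_col X"
  have X: "X \<in> carrier_mat m n" by (simp add: m_def n_def)
  from assms have P: "P \<in> carrier_mat n m" "X * P * X = X" "P * X * P = P" 
      "(X * P)\<^sup>T = X * P" "(P * X)\<^sup>T = P * X"
    and R: "R \<in> carrier_mat n m" "X * R * X = X" "R * X * R = R"
      "(X * R)\<^sup>T = X * R" "(R * X)\<^sup>T = R * X"
    unfolding is_pseudo_inverse_def m_def n_def by blast+
  have XP: "X * P \<in> carrier_mat m m" and XR: "X * R \<in> carrier_mat m m" 
    and PX: "P * X \<in> carrier_mat n n" and RX: "R * X \<in> carrier_mat n n"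
    using X P(1) R(1) by auto
  have "X * P = (X * R * X) * P" using R(2) by simp
  also have "\<dots> = (X * R) * (X * P)" by (rule assoc_mult_mat[OF XR X P(1)])
  finally have 1: "X * P = (X * R) * (X * P)" .
  have "X * R = (X * P * X) * R" using P(2) by simp
  also have "\<dots> = (X * P) * (X * R)" by (rule assoc_mult_mat[OF XP X R(1)])
  finally have "(X * R)\<^sup>T = ((X * P) * (X * R))\<^sup>T" by simp
  also have "\<dots> = (X * R) * (X * P)" 
    by (subst transpose_mult[OF XP XR]) (simp add: P R)
  finally have e1: "X * P = X * R" using 1 R(4) by simp
  have "P * X = P * (X * R * X)" using R(2) by simp
  also have "\<dots> = (P * X) * (R * X)" 
    using X P(1) R(1) by (simp add: assoc_mult_mat[of _ n m _ n _ n] assoc_mult_mat[of _ m n _ m _ n])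
  finally have 2: "P * X = (P * X) * (R * X)" .
  have "R * X = R * (X * P * X)" using P(2) by simp
  also have "\<dots> = (R * X) * (P * X)" 
    using X P(1) R(1) by (simp add: assoc_mult_mat[of _ n m _ n _ n] assoc_mult_mat[of _ m n _ m _ n])
  finally have "(R * X)\<^sup>T = ((R * X) * (P * X))\<^sup>T" by simp
  also have "\<dots> = (P * X) * (R * X)" 
    by (subst transpose_mult[OF RX PX]) (simp add: P R)
  finally have e2: "P * X = R * X" using 2 R(5) by simp
  have "P = (P * X) * P" using P(3) by simp
  also have "\<dots> = R * (X * P)" using e2 assoc_mult_mat[OF R(1) X P(1)] by simp
  also have "\<dots> = (R * X) * R" using e1 assoc_mult_mat[OF R(1) X R(1)] by simp
  finally show ?thesis using R(3) by simp
qed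

section \<open>Basic Subspace Iteration\<close>

text \<open>
  \<open>Q\<close> has as many columns as the rank of \<open>Y\<close>, which may be smaller than the number of columns of \<open>\<Omega>\<close>.
\<close>

definition is_orthonormal_col_basis :: "real mat \<Rightarrow> real mat \<Rightarrow> bool" where
  "is_orthonormal_col_basis Q Y \<longleftrightarrow>
    dim_row Q = dim_row Y \<and> Q\<^sup>T * Q = 1\<^sub>m (dim_col Q) \<and>
    vec_space.col_space (dim_row Y) Q = vec_space.col_space (dim_row Y) Y"

text \<open>
  \<open>basic_subspace_iteration A k \<ell> q \<Omega> Q B\<^sub>k\<close> says that \<open>Q\<close> and \<open>B\<^sub>k\<close> are possible results of the
  algorithm on input \<open>A, k, \<ell>, q, \<Omega>\<close>; the rank-\<open>k\<close> approximation it returns is \<open>Q * B\<^sub>k\<close>.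
\<close>

definition basic_subspace_iteration ::
  "real mat \<Rightarrow> nat \<Rightarrow> nat \<Rightarrow> nat \<Rightarrow> real mat \<Rightarrow> real mat \<Rightarrow> real mat \<Rightarrow> bool" where
  "basic_subspace_iteration A k l q \<Omega> Q Bk \<longleftrightarrow>
    \<Omega> \<in> carrier_mat (dim_col A) l \<and>
    (let Y = (A * A\<^sup>T) ^\<^sub>m q * A * \<Omega>; B = Q\<^sup>T * A in
      is_orthonormal_col_basis Q Y \<and> is_truncated_svd k B Bk)"

end

theory Submission
  imports Defs
begin

text \<open>
  Both bounds compare singular values through one side of the Courant-Fischer principle: if \<open>X\<close>
  stretches every vector of some \<open>j\<close>-dimensional subspace by at least a factor \<open>c\<close>, then
  \<open>\<sigma>\<^sub>j(X) \<ge> c\<close> (\<open>svd_value_ge_on_subspace\<close>). The reason is that the subspace meets the orthogonal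
  complement of the first \<open>j - 1\<close> right singular vectors, on which \<open>X\<close> stretches by at most \<open>\<sigma>\<^sub>j(X)\<close>.
  Write \<open>B = Q\<^sup>T A\<close>. Truncation to rank \<open>k\<close> does not change the first \<open>k\<close> singular values
  (\<open>is_svd_truncated\<close>), so \<open>\<sigma>\<^sub>j(B\<^sub>k) = \<sigma>\<^sub>j(B)\<close> for \<open>j \<le> k\<close>.

  The upper bound follows because \<open>Q\<^sup>T\<close> does not increase norms: \<open>\<parallel>B v\<parallel> \<le> \<parallel>A v\<parallel>\<close> for all \<open>v\<close>, and
  singular values are monotone in this sense (\<open>svd_value_mono\<close>).

  For the lower bound the principle is applied to \<open>B\<^sup>T\<close>, with a \<open>j\<close>-dimensional subspace of the column
  space of \<open>Y = (A A\<^sup>T)\<^sup>q A \<Omega> = U \<Sigma>\<^bsup>2q+1\<^esup> (V\<^sup>T \<Omega>)\<close>. Put \<open>s = l - p\<close> and let \<open>P\<close> be the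
  pseudo-inverse of \<open>\<Omega>1\<close>; full row rank gives \<open>\<Omega>1 P = I\<close> (\<open>pseudo_inverse_full_row_rank\<close>), so that
  \<open>Y P x = U \<Sigma>\<^bsup>2q+1\<^esup> (x, \<Omega>2 P x)\<close> for \<open>x\<close> in \<open>\<real>\<^sup>s\<close>.
  Given \<open>y\<close> in \<open>\<real>\<^sup>j\<close>, let \<open>x\<close> have the entries \<open>y\<^sub>i / \<sigma>\<^sub>i\<^bsup>2q+1\<^esup>\<close> for \<open>i \<le> j\<close> and zeros after them;
  full column rank of \<open>A\<close> makes these quotients legitimate (\<open>full_rank_svd_pos\<close>).
  The vector \<open>h = \<Sigma>\<^bsup>2q+1\<^esup> (x, \<Omega>2 P x)\<close> then starts with \<open>y\<close>, followed by zeros, and its last \<open>n - s\<close>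
  entries have norm at most \<open>\<sigma>\<^bsub>s+1\<^esub>\<^bsup>2q+1\<^esup> \<parallel>\<Omega>2\<parallel> \<parallel>P\<parallel> \<sigma>\<^sub>j\<^bsup>-(2q+1)\<^esup> \<parallel>y\<parallel>\<close>. Hence
  \<open>\<parallel>h\<parallel> \<le> K \<parallel>y\<parallel>\<close>, where \<open>K\<close> is the square root in the claim, while the first \<open>j\<close> entries alone give
  \<open>\<parallel>A\<^sup>T U h\<parallel> = \<parallel>\<Sigma> h\<parallel> \<ge> \<sigma>\<^sub>j \<parallel>y\<parallel>\<close> (\<open>amplified_vector_bounds\<close>). So \<open>A\<^sup>T\<close> stretches the vectors
  \<open>U h\<close> by at least \<open>\<sigma>\<^sub>j / K\<close>. They lie in the range of \<open>Q\<close>, and there \<open>A\<^sup>T\<close> acts as \<open>B\<^sup>T\<close> does on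
  coordinates. Because \<open>y \<mapsto> U h\<close> is injective, the same construction shows that \<open>Q\<close> has at least \<open>k\<close> columns,
  so that \<open>\<sigma>\<^sub>1(B), \<dots>, \<sigma>\<^sub>k(B)\<close> exist (\<open>subspace_iteration_lower_bound\<close>).
\<close>

section \<open>Euclidean norm and spectral norm\<close>

lemma vec_norm2_sq: "(vec_norm2 v)\<^sup>2 = (\<Sum>i<dim_vec v. (v $ i)\<^sup>2)"
  unfolding vec_norm2_def scalar_prod_def
  by (subst real_sqrt_pow2) (auto simp: sum_nonneg power2_eq_square atLeast0LessThan)

lemma vec_norm2_nonneg [simp]: "0 \<le> vec_norm2 v"
  by (simp add: vec_norm2_def scalar_prod_def sum_nonneg)

lemma scalar_prod_self_eq: "v \<bullet> v = (vec_norm2 v)\<^sup>2"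
  unfolding vec_norm2_sq scalar_prod_def by (simp add: power2_eq_square atLeast0LessThan)

lemma vec_norm2_pos:
  assumes "v \<in> carrier_vec n" "v \<noteq> 0\<^sub>v n"
  shows "0 < vec_norm2 v"
proof -
  obtain i where i: "i < n" "v $ i \<noteq> 0" using assms by (metis carrier_vecD eq_vecI index_zero_vec)
  have "0 < (\<Sum>i<dim_vec v. (v $ i)\<^sup>2)"
    using i assms by (intro sum_pos2[of _ i]) auto
  then show ?thesis using vec_norm2_sq[of v] vec_norm2_nonneg[of v] 
    by (metis less_eq_real_def power_zero_numeral order_less_irrefl)
qed

lemma vec_norm2_zero [simp]: "vec_norm2 (0\<^sub>v n) = 0"
  by (simp add: vec_norm2_def)

lemma vec_norm2_smult: "vec_norm2 (c \<cdot>\<^sub>v v) = \<bar>c\<bar> * vec_norm2 v"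
proof -
  have "(vec_norm2 (c \<cdot>\<^sub>v v))\<^sup>2 = (\<bar>c\<bar> * vec_norm2 v)\<^sup>2"
    unfolding power_mult_distrib vec_norm2_sq by (simp add: power_mult_distrib sum_distrib_left)
  then show ?thesis by (simp add: power2_eq_iff_nonneg)
qed

lemma vec_norm2_isometry:
  assumes U: "U \<in> carrier_mat m d" and UU: "U\<^sup>T * U = 1\<^sub>m d" and x: "x \<in> carrier_vec d"
  shows "vec_norm2 (U *\<^sub>v x) = vec_norm2 x"
proof -
  have "(U *\<^sub>v x) \<bullet> (U *\<^sub>v x) = (U\<^sup>T *\<^sub>v (U *\<^sub>v x)) \<bullet> x"
    using U x by (intro transpose_vec_mult_scalar[symmetric]) auto
  also have "U\<^sup>T *\<^sub>v (U *\<^sub>v x) = x"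
    using U x UU by (subst assoc_mult_mat_vec[symmetric]) auto
  finally show ?thesis by (simp add: vec_norm2_def)
qed

text \<open>
  Bessel's inequality: \<open>U\<^sup>T v\<close> holds the coordinates of the orthogonal projection of \<open>v\<close> to the range of
  \<open>U\<close>, and the squared distance of \<open>v\<close> to that projection is \<open>\<parallel>v\<parallel>\<^sup>2 - \<parallel>U\<^sup>T v\<parallel>\<^sup>2\<close>.
\<close>

lemma vec_norm2_coisometry_le:
  assumes U: "U \<in> carrier_mat m d" and UU: "U\<^sup>T * U = 1\<^sub>m d" and v: "v \<in> carrier_vec m"
  shows "vec_norm2 (U\<^sup>T *\<^sub>v v) \<le> vec_norm2 v"
proof -
  define p where "p = U\<^sup>T *\<^sub>v v"
  have p: "p \<in> carrier_vec d" using U v by (simp add: p_def)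
  have Up: "U *\<^sub>v p \<in> carrier_vec m" using U p by simp
  have "0 \<le> (v - U *\<^sub>v p) \<bullet> (v - U *\<^sub>v p)" by (simp add: scalar_prod_self_eq)
  also have "\<dots> = v \<bullet> v - 2 * (v \<bullet> (U *\<^sub>v p)) + (U *\<^sub>v p) \<bullet> (U *\<^sub>v p)"
    using v Up by (simp add: minus_scalar_prod_distrib[of _ m] scalar_prod_minus_distrib[of _ m] 
        comm_scalar_prod[OF v Up])
  also have "(U *\<^sub>v p) \<bullet> (U *\<^sub>v p) = p \<bullet> p"
    using vec_norm2_isometry[OF U UU p] by (simp add: scalar_prod_self_eq)
  also have "v \<bullet> (U *\<^sub>v p) = p \<bullet> p"
    using transpose_vec_mult_scalar[OF U p v] by (simp add: p_def)
  finally have "(vec_norm2 p)\<^sup>2 \<le> (vec_norm2 v)\<^sup>2" by (simp add: scalar_prod_self_eq)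
  then show ?thesis unfolding p_def by (simp add: power2_le_iff_abs_le)
qed

text \<open>
  The supremum that defines the spectral norm is finite: on the unit ball every entry of \<open>v\<close> is at most
  \<open>1\<close> in absolute value, so the entries of \<open>X v\<close> are bounded by the absolute row sums of \<open>X\<close>.
\<close>

lemma spectral_norm_bdd:
  "bdd_above ((\<lambda>v. vec_norm2 (X *\<^sub>v v)) ` {v \<in> carrier_vec (dim_col X). vec_norm2 v \<le> 1})"
proof (rule bdd_aboveI2)
  fix v assume v: "v \<in> {v \<in> carrier_vec (dim_col X). vec_norm2 v \<le> 1}"
  have entry: "\<bar>v $ i\<bar> \<le> 1" if "i < dim_col X" for i
  proof -
    have "(v $ i)\<^sup>2 \<le> (\<Sum>i<dim_vec v. (v $ i)\<^sup>2)"
      using that v by (intro member_le_sum) auto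
    also have "\<dots> \<le> 1" unfolding vec_norm2_sq[symmetric] using v by (simp add: power_le_one)
    finally show ?thesis by (simp add: abs_square_le_1)
  qed
  have "(vec_norm2 (X *\<^sub>v v))\<^sup>2 \<le> (\<Sum>i<dim_row X. (\<Sum>j<dim_col X. \<bar>X $$ (i,j)\<bar>)\<^sup>2)"
    unfolding vec_norm2_sq
  proof (simp, rule sum_mono)
    fix i assume i: "i \<in> {..<dim_row X}"
    have "\<bar>row X i \<bullet> v\<bar> \<le> (\<Sum>j<dim_col X. \<bar>X $$ (i,j) * v $ j\<bar>)"
      unfolding scalar_prod_def using v i by (auto simp: atLeast0LessThan intro: order.trans[OF sum_abs])
    also have "\<dots> \<le> (\<Sum>j<dim_col X. \<bar>X $$ (i,j)\<bar>)"
      using entry by (intro sum_mono) (auto simp: abs_mult intro!: mult_left_le)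
    finally show "(row X i \<bullet> v)\<^sup>2 \<le> (\<Sum>j<dim_col X. \<bar>X $$ (i,j)\<bar>)\<^sup>2"
      using abs_le_square_iff[of "row X i \<bullet> v" "\<Sum>j<dim_col X. \<bar>X $$ (i,j)\<bar>"]
      by (simp add: sum_nonneg)
  qed
  then show "vec_norm2 (X *\<^sub>v v) \<le> sqrt (\<Sum>i<dim_row X. (\<Sum>j<dim_col X. \<bar>X $$ (i,j)\<bar>)\<^sup>2)"
    by (rule real_le_rsqrt)
qed

lemma spectral_norm_nonneg [simp]: "0 \<le> spectral_norm X"
  unfolding spectral_norm_def
  by (rule cSUP_upper2[OF spectral_norm_bdd, of "0\<^sub>v (dim_col X)"]) auto

lemma vec_norm2_mult_le_spectral:
  assumes X: "X \<in> carrier_mat r c" and v: "v \<in> carrier_vec c"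
  shows "vec_norm2 (X *\<^sub>v v) \<le> spectral_norm X * vec_norm2 v"
proof (cases "v = 0\<^sub>v c")
  case True
  then have "X *\<^sub>v v = 0\<^sub>v r" using X by (intro eq_vecI) auto
  then show ?thesis using True by simp
next
  case False
  then have pos: "0 < vec_norm2 v" using v by (rule vec_norm2_pos[rotated])
  define w where "w = (1 / vec_norm2 v) \<cdot>\<^sub>v v"
  have w: "w \<in> carrier_vec (dim_col X)" using v X by (simp add: w_def)
  have "vec_norm2 w = 1" using pos by (simp add: w_def vec_norm2_smult)
  then have "vec_norm2 (X *\<^sub>v w) \<le> spectral_norm X"
    unfolding spectral_norm_def using w by (intro cSUP_upper[OF _ spectral_norm_bdd]) auto
  moreover have "X *\<^sub>v w = (1 / vec_norm2 v) \<cdot>\<^sub>v (X *\<^sub>v v)"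
    using X v by (simp add: w_def mult_mat_vec)
  ultimately show ?thesis using pos by (simp add: vec_norm2_smult field_simps)
qed

section \<open>Rank and pseudo-inverse\<close>

text \<open>
  Padding \<open>M\<close> with zero rows makes it a singular square matrix, and the vanishing of its determinant
  yields the kernel vector. This is the only dimension count behind the comparison of singular values.
\<close>

lemma underdetermined_nontrivial_kernel:
  fixes M :: "'a :: field mat"
  assumes M: "M \<in> carrier_mat a b" and ab: "a < b"
  obtains y where "y \<in> carrier_vec b" "y \<noteq> 0\<^sub>v b" "M *\<^sub>v y = 0\<^sub>v a"
proof -
  define N where "N = mat b b (\<lambda>(i,j). if i < a then M $$ (i,j) else 0)"
  have N: "N \<in> carrier_mat b b" by (simp add: N_def)
  have "det N\<^sup>T = 0"
  proof (subst det_0_iff_vec_prod_zero[of _ b], simp add: N, intro exI conjI)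
    show "unit_vec b a \<in> carrier_vec b" by simp
    show "unit_vec b a \<noteq> 0\<^sub>v b" using ab by (metis index_unit_vec(1) index_zero_vec(1) zero_neq_one)
    show "N\<^sup>T *\<^sub>v unit_vec b a = 0\<^sub>v b"
      using ab N by (intro eq_vecI) (auto simp: N_def row_transpose)
  qed
  then have "det N = 0" using det_transpose[OF N] by simp
  then obtain y where y: "y \<in> carrier_vec b" "y \<noteq> 0\<^sub>v b" "N *\<^sub>v y = 0\<^sub>v b"
    using det_0_iff_vec_prod_zero[OF N] by blast
  have "M *\<^sub>v y = 0\<^sub>v a"
  proof (rule eq_vecI)
    fix i assume i: "i < dim_vec (0\<^sub>v a)"
    have "row M i = row N i" using i ab M by (intro eq_vecI) (auto simp: N_def)
    moreover have "(N *\<^sub>v y) $ i = 0" using y(3) i ab by simp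
    ultimately show "(M *\<^sub>v y) $ i = 0\<^sub>v a $ i" using i ab M N by simp
  qed (use M in auto)
  then show thesis using that y by blast
qed

lemma (in vec_space) obtain_independent_columns:
  assumes A: "A \<in> carrier_mat n c"
  obtains S where "S \<subseteq> set (cols A)" "lin_indpt S" "card S = rank A"
proof -
  obtain S where S: "maximal S (\<lambda>T. T \<subseteq> set (cols A) \<and> lin_indpt T)"
    using maximal_exists_superset[of "set (cols A)" "\<lambda>T. T \<subseteq> set (cols A) \<and> lin_indpt T" "{}"]
    by (auto simp: lin_dep_def)
  then have "S \<subseteq> set (cols A)" "lin_indpt S" by (auto simp: maximal_def)
  then show thesis using that rank_card_indpt[OF A S] by metis
qed

lemma full_column_rank_kernel:
  assumes A: "A \<in> carrier_mat n c" and rk: "vec_space.rank n A = c"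
    and v: "v \<in> carrier_vec c" and Av: "A *\<^sub>v v = 0\<^sub>v n"
  shows "v = (0\<^sub>v c :: 'a :: field vec)"
proof (rule ccontr)
  assume "v \<noteq> 0\<^sub>v c"
  interpret vec_space "TYPE('a)" n .
  obtain S where "S \<subseteq> set (cols A)" "card S = c"
    using obtain_independent_columns[OF A] rk by metis
  \<comment> \<open>As linear independence concerns the set of columns, repeated columns have to be excluded first.\<close>
  then have "c \<le> card (set (cols A))" by (metis List.finite_set card_mono)
  then have "distinct (cols A)"
    using A card_length[of "cols A"] by (intro card_distinct) auto
  from lin_depI[OF A v \<open>v \<noteq> 0\<^sub>v c\<close> Av this] full_rank_lin_indpt[OF A rk this] show False by blast
qed

text \<open>
  Choosing \<open>n\<close> independent columns of \<open>A\<close> gives an invertible square matrix \<open>M\<close>, and \<open>A\<^sup>T v = 0\<close>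
  contains the equations \<open>M\<^sup>T v = 0\<close>.
\<close>

lemma full_row_rank_left_kernel:
  assumes A: "A \<in> carrier_mat n c" and rk: "vec_space.rank n A = n"
    and v: "v \<in> carrier_vec n" and Av: "A\<^sup>T *\<^sub>v v = 0\<^sub>v c"
  shows "v = (0\<^sub>v n :: 'a :: field vec)"
proof (rule ccontr)
  assume "v \<noteq> 0\<^sub>v n"
  interpret vec_space "TYPE('a)" n .
  obtain S where sub: "S \<subseteq> set (cols A)" and ind: "lin_indpt S" and cS: "card S = n"
    using obtain_independent_columns[OF A] rk by metis
  have "finite S" using sub by (rule finite_subset) simp
  then obtain xs where xs: "set xs = S" "distinct xs" using finite_distinct_list by blast
  have len: "length xs = n" using cS xs distinct_card by metis
  have xsc: "set xs \<subseteq> carrier_vec n" using sub xs cols_dim[of A] A by auto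
  define M where "M = mat_of_cols n xs"
  have M: "M \<in> carrier_mat n n" using mat_of_cols_carrier(1)[of n xs] unfolding M_def len .
  have cM: "cols M = xs" unfolding M_def using xsc by (rule cols_mat_of_cols)
  have "rank M = n" using lin_indpt_full_rank[OF M] cM xs ind by simp
  then have "det M \<noteq> 0" using det_rank_iff[OF M] by simp
  moreover have "M\<^sup>T *\<^sub>v v = 0\<^sub>v n"
  proof (rule eq_vecI)
    fix i assume i: "i < dim_vec (0\<^sub>v n :: 'a vec)"
    have "col M i \<in> set (cols A)" using cM sub xs i len M by (metis carrier_matD(2) cols_nth index_zero_vec(2) nth_mem subsetD)
    then obtain i' where i': "i' < c" "col M i = col A i'" using A by (auto simp: cols_def)
    have "col A i' \<bullet> v = (A\<^sup>T *\<^sub>v v) $ i'" using i' A by simp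
    then show "(M\<^sup>T *\<^sub>v v) $ i = 0\<^sub>v n $ i" using i M i' Av by simp
  qed (use M in auto)
  ultimately show False
    using det_0_iff_vec_prod_zero[of "M\<^sup>T" n] M v \<open>v \<noteq> 0\<^sub>v n\<close> det_transpose[OF M] by auto
qed

text \<open>
  Full row rank makes the Gram matrix \<open>X X\<^sup>T\<close> invertible, and \<open>X\<^sup>T (X X\<^sup>T)\<^bsup>-1\<^esup>\<close> is a right inverse
  of \<open>X\<close> that satisfies the Penrose equations; their solution is unique.
\<close>

lemma pseudo_inverse_full_row_rank:
  assumes X: "X \<in> carrier_mat r c" and rk: "vec_space.rank r X = r"
  shows "pseudo_inverse X \<in> carrier_mat c r" "X * pseudo_inverse X = 1\<^sub>m r"
proof -
  have XT: "X\<^sup>T \<in> carrier_mat c r" using X by simp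
  define G where "G = X * X\<^sup>T"
  have G: "G \<in> carrier_mat r r" using X by (simp add: G_def)
  have GT: "G\<^sup>T = G" unfolding G_def using transpose_mult[OF X XT] by simp
  have "det G \<noteq> 0"
  proof
    assume "det G = 0"
    then obtain v where v: "v \<in> carrier_vec r" "v \<noteq> 0\<^sub>v r" "G *\<^sub>v v = 0\<^sub>v r"
      using det_0_iff_vec_prod_zero[OF G] by blast
    have XTv: "X\<^sup>T *\<^sub>v v \<in> carrier_vec c" using XT v by simp
    have "X *\<^sub>v (X\<^sup>T *\<^sub>v v) = 0\<^sub>v r" using v X unfolding G_def by (simp add: assoc_mult_mat_vec[OF X XT])
    then have "(X\<^sup>T *\<^sub>v v) \<bullet> (X\<^sup>T *\<^sub>v v) = 0"
      using transpose_vec_mult_scalar[OF X XTv v(1)] v by simp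
    then have "vec_norm2 (X\<^sup>T *\<^sub>v v) = 0" by (simp add: vec_norm2_def)
    then have "X\<^sup>T *\<^sub>v v = 0\<^sub>v c" using vec_norm2_pos[OF XTv] by fastforce
    then show False using full_row_rank_left_kernel[OF X rk v(1)] v(2) by simp
  qed
  from det_non_zero_imp_unit[OF G this, of "()"]
  obtain H where H: "H \<in> carrier_mat r r" "H * G = 1\<^sub>m r" "G * H = 1\<^sub>m r"
    unfolding Units_def ring_mat_def by auto
  define P where "P = X\<^sup>T * H"
  have P: "P \<in> carrier_mat c r" using XT H by (simp add: P_def)
  have XP: "X * P = 1\<^sub>m r" unfolding P_def using assoc_mult_mat[OF X XT H(1)] H(3) by (simp add: G_def)
  have HT: "H\<^sup>T \<in> carrier_mat r r" using H by simp
  have "G * H\<^sup>T = 1\<^sub>m r" using transpose_mult[OF H(1) G] H(2) GT by simp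
  then have "H\<^sup>T = H * G * H\<^sup>T" "H * G * H\<^sup>T = H" 
    using H HT G assoc_mult_mat[OF H(1) G HT] by auto
  then have HTH: "H\<^sup>T = H" by simp
  have "(P * X)\<^sup>T = X\<^sup>T * P\<^sup>T" by (rule transpose_mult[OF P X])
  also have "P\<^sup>T = H * X" unfolding P_def using transpose_mult[OF XT H(1)] HTH by simp
  also have "X\<^sup>T * (H * X) = P * X" unfolding P_def by (rule assoc_mult_mat[OF XT H(1) X, symmetric])
  finally have PXT: "(P * X)\<^sup>T = P * X" .
  have "P * X * P = P" using assoc_mult_mat[OF P X P] XP P by simp
  then have pi: "is_pseudo_inverse X P"
    unfolding is_pseudo_inverse_def using X P XP PXT by simp
  then have "pseudo_inverse X = P"
    unfolding pseudo_inverse_def using pseudo_inverse_unique[OF _ pi] by (intro the_equality)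
  then show "pseudo_inverse X \<in> carrier_mat c r" "X * pseudo_inverse X = 1\<^sub>m r" using P XP by auto
qed

section \<open>Diagonal matrices and singular value decompositions\<close>

lemma rect_diag_mult_vec:
  fixes y :: "'a :: semiring_0 vec"
  assumes y: "y \<in> carrier_vec j"
  shows "mat d j (\<lambda>(i, i'). if i = i' then f i else 0) *\<^sub>v y = vec d (\<lambda>i. if i < j then f i * y $ i else 0)"
proof (rule eq_vecI)
  fix i assume "i < dim_vec (vec d (\<lambda>i. if i < j then f i * y $ i else 0))"
  then have i: "i < d" by simp
  have "row (mat d j (\<lambda>(i, i'). if i = i' then f i else 0)) i \<bullet> y =
      (\<Sum>i'<j. if i' = i then f i * y $ i else 0)"
    using i y unfolding scalar_prod_def atLeast0LessThan
    by (auto simp del: sum.delta sum.delta' intro!: sum.cong)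
  then show "(mat d j (\<lambda>(i, i'). if i = i' then f i else 0) *\<^sub>v y) $ i =
      vec d (\<lambda>i. if i < j then f i * y $ i else 0) $ i"
    using i by simp
qed simp

lemma mat_diag_mult_vec:
  fixes v :: "'a :: semiring_1 vec"
  assumes "v \<in> carrier_vec n"
  shows "mat_diag n f *\<^sub>v v = vec n (\<lambda>i. f i * v $ i)"
proof -
  have "mat_diag n f = mat n n (\<lambda>(i, i'). if i = i' then f i else 0)"
    by (auto simp: mat_diag_def intro!: eq_matI)
  then show ?thesis using rect_diag_mult_vec[OF assms, of n f] by (auto intro!: eq_vecI)
qed

lemma is_svdD:
  assumes "is_svd X U \<sigma> V" and X: "X \<in> carrier_mat m n"
  shows "U \<in> carrier_mat m (min m n)" "U\<^sup>T * U = 1\<^sub>m (min m n)"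
    "V \<in> carrier_mat n (min m n)" "V\<^sup>T * V = 1\<^sub>m (min m n)"
    "\<And>j. j \<in> {1..min m n} \<Longrightarrow> 0 \<le> \<sigma> j"
    "\<And>i j. 1 \<le> i \<Longrightarrow> i \<le> j \<Longrightarrow> j \<le> min m n \<Longrightarrow> \<sigma> j \<le> \<sigma> i"
    "X = U * mat_diag (min m n) (\<lambda>i. \<sigma> (Suc i)) * V\<^sup>T"
proof -
  have d: "min (dim_row X) (dim_col X) = min m n" "dim_row X = m" "dim_col X = n" using X by auto
  note s = assms(1)[unfolded is_svd_def Let_def d]
  show "U \<in> carrier_mat m (min m n)" "U\<^sup>T * U = 1\<^sub>m (min m n)"
    "V \<in> carrier_mat n (min m n)" "V\<^sup>T * V = 1\<^sub>m (min m n)"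
    "X = U * mat_diag (min m n) (\<lambda>i. \<sigma> (Suc i)) * V\<^sup>T" using s by blast+
  show "0 \<le> \<sigma> j" if "j \<in> {1..min m n}" for j using s that by blast
  show "\<sigma> j \<le> \<sigma> i" if "1 \<le> i" "i \<le> j" "j \<le> min m n" for i j using s that by auto
qed

lemma svd_mult_vec:
  assumes svd: "is_svd X U \<sigma> V" and X: "X \<in> carrier_mat m n" and v: "v \<in> carrier_vec n"
  shows "X *\<^sub>v v = U *\<^sub>v (mat_diag (min m n) (\<lambda>i. \<sigma> (Suc i)) *\<^sub>v (V\<^sup>T *\<^sub>v v))"
proof -
  note s = is_svdD[OF svd X]
  have "X *\<^sub>v v = (U * mat_diag (min m n) (\<lambda>i. \<sigma> (Suc i)) * V\<^sup>T) *\<^sub>v v" using s(7) by simp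
  also have "\<dots> = U *\<^sub>v (mat_diag (min m n) (\<lambda>i. \<sigma> (Suc i)) *\<^sub>v (V\<^sup>T *\<^sub>v v))"
  proof -
    let ?D = "mat_diag (min m n) (\<lambda>i. \<sigma> (Suc i))"
    have UD: "U * ?D \<in> carrier_mat m (min m n)" using s(1) by (intro mult_carrier_mat[OF _ mat_diag_dim])
    have VT: "V\<^sup>T \<in> carrier_mat (min m n) n" using s(3) by simp
    show ?thesis
      using assoc_mult_mat_vec[OF UD VT v]
        assoc_mult_mat_vec[OF s(1) mat_diag_dim mult_mat_vec_carrier[OF VT v]] by simp
  qed
  finally show ?thesis .
qed

lemma svd_norm_mult:
  assumes svd: "is_svd X U \<sigma> V" and X: "X \<in> carrier_mat m n" and v: "v \<in> carrier_vec n"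
  shows "vec_norm2 (X *\<^sub>v v) = vec_norm2 (mat_diag (min m n) (\<lambda>i. \<sigma> (Suc i)) *\<^sub>v (V\<^sup>T *\<^sub>v v))"
proof -
  note s = is_svdD[OF svd X]
  have "V\<^sup>T *\<^sub>v v \<in> carrier_vec (min m n)" using s(3) v by simp
  from mult_mat_vec_carrier[OF mat_diag_dim this]
  show ?thesis unfolding svd_mult_vec[OF assms] by (rule vec_norm2_isometry[OF s(1,2)])
qed

section \<open>Comparison of singular values\<close>

text \<open>
  The subspace is the range of the injective matrix \<open>T\<close>. It contains a nonzero vector orthogonal to the
  first \<open>j - 1\<close> columns of \<open>V\<close>, since these are only \<open>j - 1\<close> conditions on \<open>j\<close> unknowns. On such a vector
  \<open>X\<close> acts through the singular values from \<open>\<sigma> j\<close> on.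
\<close>

lemma svd_value_ge_on_subspace:
  assumes svd: "is_svd X U \<sigma> V" and X: "X \<in> carrier_mat m n" and T: "T \<in> carrier_mat n j"
    and j: "1 \<le> j" "j \<le> min m n"
    and inj: "\<And>y. y \<in> carrier_vec j \<Longrightarrow> T *\<^sub>v y = 0\<^sub>v n \<Longrightarrow> y = 0\<^sub>v j"
    and bound: "\<And>y. y \<in> carrier_vec j \<Longrightarrow> c * vec_norm2 (T *\<^sub>v y) \<le> vec_norm2 (X *\<^sub>v (T *\<^sub>v y))"
  shows "c \<le> \<sigma> j"
proof -
  define d where "d = min m n"
  note s = is_svdD[OF svd X, folded d_def]
  define N where "N = V\<^sup>T * T"
  have N: "N \<in> carrier_mat d j" using s(3) T by (simp add: N_def)
  define M where "M = mat (j - 1) j (\<lambda>(i,i'). N $$ (i,i'))"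
  have M: "M \<in> carrier_mat (j - 1) j" by (simp add: M_def)
  obtain y where y: "y \<in> carrier_vec j" "y \<noteq> 0\<^sub>v j" "M *\<^sub>v y = 0\<^sub>v (j - 1)"
    using underdetermined_nontrivial_kernel[OF M] j by auto
  define v where "v = T *\<^sub>v y"
  define w where "w = V\<^sup>T *\<^sub>v v"
  have v: "v \<in> carrier_vec n" using T y by (simp add: v_def)
  have w: "w \<in> carrier_vec d" using s(3) v by (simp add: w_def)
  have wN: "w = N *\<^sub>v y" unfolding w_def v_def N_def
    using s(3) T y by (intro assoc_mult_mat_vec[symmetric]) auto
  have w0: "w $ i = 0" if i: "i < j - 1" for i
  proof -
    have "row M i = row N i" using i N j unfolding d_def[symmetric] by (intro eq_vecI) (auto simp: M_def)
    moreover have "(M *\<^sub>v y) $ i = 0" using y(3) i by simp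
    ultimately show ?thesis using i N M j unfolding d_def[symmetric] by (simp add: wN)
  qed
  have "(vec_norm2 (X *\<^sub>v v))\<^sup>2 = (\<Sum>i<d. (\<sigma> (Suc i) * w $ i)\<^sup>2)"
    unfolding svd_norm_mult[OF svd X v] d_def[symmetric] w_def[symmetric] mat_diag_mult_vec[OF w]
    by (simp add: vec_norm2_sq)
  also have "\<dots> \<le> (\<Sum>i<d. (\<sigma> j * w $ i)\<^sup>2)"
  proof (rule sum_mono)
    fix i assume i: "i \<in> {..<d}"
    show "(\<sigma> (Suc i) * w $ i)\<^sup>2 \<le> (\<sigma> j * w $ i)\<^sup>2"
    proof (cases "i < j - 1")
      case False
      then have "\<sigma> (Suc i) \<le> \<sigma> j" "0 \<le> \<sigma> (Suc i)" using s(5)[of "Suc i"] s(6)[of j "Suc i"] i j by auto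
      then show ?thesis by (auto simp: power_mult_distrib intro!: mult_right_mono power_mono)
    qed (simp add: w0)
  qed
  also have "\<dots> = (\<sigma> j * vec_norm2 w)\<^sup>2"
    using w by (simp add: power_mult_distrib vec_norm2_sq sum_distrib_left)
  finally have "vec_norm2 (X *\<^sub>v v) \<le> \<sigma> j * vec_norm2 w"
    using s(5)[of j] j by (simp add: power2_le_iff_abs_le d_def)
  also have "\<dots> \<le> \<sigma> j * vec_norm2 v"
    unfolding w_def using s(5)[of j] j vec_norm2_coisometry_le[OF s(3,4) v]
    by (intro mult_left_mono) (auto simp: d_def)
  finally have "c * vec_norm2 v \<le> \<sigma> j * vec_norm2 v" using bound[OF y(1)] by (simp add: v_def)
  moreover have "0 < vec_norm2 v" using inj[OF y(1)] y(2) v by (intro vec_norm2_pos) (auto simp: v_def)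
  ultimately show ?thesis by simp
qed

text \<open>
  On the span of its first \<open>j\<close> right singular vectors, \<open>X\<close> stretches by at least \<open>\<sigma> j\<close>, and then so
  does \<open>A\<close>.
\<close>

lemma svd_value_mono:
  assumes svdX: "is_svd X U \<sigma> V" and X: "X \<in> carrier_mat r n"
    and svdA: "is_svd A U' \<tau> V'" and A: "A \<in> carrier_mat m n"
    and j: "1 \<le> j" "j \<le> min r n" "j \<le> min m n"
    and le: "\<And>v. v \<in> carrier_vec n \<Longrightarrow> vec_norm2 (X *\<^sub>v v) \<le> vec_norm2 (A *\<^sub>v v)"
  shows "\<sigma> j \<le> \<tau> j"
proof -
  define d where "d = min r n"
  note s = is_svdD[OF svdX X, folded d_def]
  define E where "E = mat d j (\<lambda>(i,i'). if i = i' then 1 else 0 :: real)"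
  \<comment> \<open>The columns of \<open>T\<close> are the first \<open>j\<close> columns of \<open>V\<close>.\<close>
  define T where "T = V * E"
  have E: "E \<in> carrier_mat d j" and T: "T \<in> carrier_mat n j" using s by (auto simp: E_def T_def)
  have Ey: "E *\<^sub>v y = vec d (\<lambda>i. if i < j then y $ i else 0)" if y: "y \<in> carrier_vec j" for y
    using rect_diag_mult_vec[OF y, of d "\<lambda>_. 1"] by (simp add: E_def cong: if_cong)
  have Ty: "T *\<^sub>v y = V *\<^sub>v (E *\<^sub>v y)" if y: "y \<in> carrier_vec j" for y
    unfolding T_def using s(3) E y by (intro assoc_mult_mat_vec) auto
  have nT: "vec_norm2 (T *\<^sub>v y) = vec_norm2 (E *\<^sub>v y)" if y: "y \<in> carrier_vec j" for y
    unfolding Ty[OF y] using s(3,4) E y by (intro vec_norm2_isometry[of _ n d]) auto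
  show ?thesis
  proof (rule svd_value_ge_on_subspace[OF svdA A T j(1,3)])
    fix y :: "real vec" assume y: "y \<in> carrier_vec j" and "T *\<^sub>v y = 0\<^sub>v n"
    then have "vec_norm2 (E *\<^sub>v y) = 0" using nT[OF y] by simp
    then have "E *\<^sub>v y = 0\<^sub>v d" using vec_norm2_pos[of "E *\<^sub>v y" d] E y by fastforce
    then have e0: "vec d (\<lambda>i. if i < j then y $ i else 0) $ i = 0" if "i < d" for i
      using Ey[OF y] that by simp
    have "y $ i = 0" if "i < j" for i using e0[of i] that j by (simp add: d_def)
    then show "y = 0\<^sub>v j" using y by (intro eq_vecI) auto
  next
    fix y :: "real vec" assume y: "y \<in> carrier_vec j"
    define e where "e = E *\<^sub>v y"
    have e: "e \<in> carrier_vec d" using E y by (simp add: e_def)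
    have Tyc: "T *\<^sub>v y \<in> carrier_vec n" using T y by simp
    have VT: "V\<^sup>T *\<^sub>v (T *\<^sub>v y) = e"
      unfolding Ty[OF y] e_def[symmetric] using s(3,4) e by (subst assoc_mult_mat_vec[symmetric]) auto
    have "(\<sigma> j * vec_norm2 e)\<^sup>2 = (\<Sum>i<d. (\<sigma> j * e $ i)\<^sup>2)"
      using e by (simp add: power_mult_distrib vec_norm2_sq sum_distrib_left)
    also have "\<dots> \<le> (\<Sum>i<d. (\<sigma> (Suc i) * e $ i)\<^sup>2)"
    proof (rule sum_mono)
      fix i assume i: "i \<in> {..<d}"
      show "(\<sigma> j * e $ i)\<^sup>2 \<le> (\<sigma> (Suc i) * e $ i)\<^sup>2"
      proof (cases "i < j")
        case True
        then have "\<sigma> j \<le> \<sigma> (Suc i)" "0 \<le> \<sigma> j" using s(5)[of j] s(6)[of "Suc i" j] j by (auto simp: d_def)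
        then show ?thesis by (auto simp: power_mult_distrib intro!: mult_right_mono power_mono)
      next
        case False
        then show ?thesis using i by (simp add: e_def Ey[OF y])
      qed
    qed
    also have "\<dots> = (vec_norm2 (X *\<^sub>v (T *\<^sub>v y)))\<^sup>2"
      unfolding svd_norm_mult[OF svdX X Tyc] d_def[symmetric] VT mat_diag_mult_vec[OF e]
      by (simp add: vec_norm2_sq)
    finally have "\<sigma> j * vec_norm2 e \<le> vec_norm2 (X *\<^sub>v (T *\<^sub>v y))"
      by (rule power2_le_imp_le) simp
    also have "\<dots> \<le> vec_norm2 (A *\<^sub>v (T *\<^sub>v y))" by (rule le[OF Tyc])
    finally show "\<sigma> j * vec_norm2 (T *\<^sub>v y) \<le> vec_norm2 (A *\<^sub>v (T *\<^sub>v y))"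
      using nT[OF y] by (simp add: e_def)
  qed
qed

text \<open>A vanishing singular value would put a column of \<open>V\<close> into the kernel of \<open>A\<close>.\<close>

lemma full_rank_svd_pos:
  assumes svd: "is_svd A U \<sigma> V" and A: "A \<in> carrier_mat m n" and mn: "n \<le> m"
    and rk: "vec_space.rank m A = n" and j: "j \<in> {1..n}"
  shows "0 < \<sigma> j"
proof -
  have d: "min m n = n" using mn by simp
  note s = is_svdD[OF svd A, unfolded d]
  define e :: "real vec" where "e = unit_vec n (j - 1)"
  have e: "e \<in> carrier_vec n" by (simp add: e_def)
  have Ve: "V *\<^sub>v e \<in> carrier_vec n" using s(3) e by simp
  have VVe: "V\<^sup>T *\<^sub>v (V *\<^sub>v e) = e"
    using s(3,4) e by (subst assoc_mult_mat_vec[symmetric]) auto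
  have "\<sigma> j \<noteq> 0"
  proof
    assume z: "\<sigma> j = 0"
    have "mat_diag n (\<lambda>i. \<sigma> (Suc i)) *\<^sub>v e = 0\<^sub>v n"
      unfolding mat_diag_mult_vec[OF e] using j z by (intro eq_vecI) (auto simp: e_def unit_vec_def)
    then have "A *\<^sub>v (V *\<^sub>v e) = 0\<^sub>v m"
      unfolding svd_mult_vec[OF svd A Ve] d VVe using s(1) by (intro eq_vecI) auto
    then have "V *\<^sub>v e = 0\<^sub>v n" by (rule full_column_rank_kernel[OF A rk Ve])
    then have "e = V\<^sup>T *\<^sub>v 0\<^sub>v n" using VVe by simp
    then have "e = 0\<^sub>v n" using s(3) by (auto intro!: eq_vecI)
    moreover have "j - 1 < n" using j by auto
    ultimately have "e $ (j - 1) = 0" by simp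
    then show False using \<open>j - 1 < n\<close> by (simp add: e_def)
  qed
  then show ?thesis using s(5)[OF j] by simp
qed

text \<open>
  The truncated matrix is decomposed by the same factors \<open>U\<close> and \<open>V\<close>, with all singular values beyond
  the \<open>k\<close>-th replaced by zero; in particular the first \<open>k\<close> singular values survive.
\<close>

lemma is_svd_truncated:
  assumes svd: "is_svd X U \<sigma> V" and X: "X \<in> carrier_mat m n" and k: "k \<le> min m n"
    and Xk: "Xk = mat_of_cols m (take k (cols U)) * mat_diag k (\<lambda>i. \<sigma> (Suc i)) *
        (mat_of_cols n (take k (cols V)))\<^sup>T"
  shows "is_svd Xk U (\<lambda>i. if i \<le> k then \<sigma> i else 0) V"
proof -
  define d where "d = min m n"
  note s = is_svdD[OF svd X, folded d_def]
  define Uk where "Uk = mat_of_cols m (take k (cols U))"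
  define Vk where "Vk = mat_of_cols n (take k (cols V))"
  have kd: "k \<le> d" using k by (simp add: d_def)
  have Uk: "Uk \<in> carrier_mat m k" and Vk: "Vk \<in> carrier_mat n k"
    using s(1,3) kd mat_of_cols_carrier(1)[of m "take k (cols U)"] mat_of_cols_carrier(1)[of n "take k (cols V)"]
    unfolding Uk_def Vk_def by (simp_all add: min_absorb1 min_absorb2)
  have Ukij: "Uk $$ (a,i) = U $$ (a,i)" if "a < m" "i < k" for a i
    using that s(1) kd by (simp add: Uk_def mat_of_cols_index)
  have Vkij: "Vk $$ (a,i) = V $$ (a,i)" if "a < n" "i < k" for a i
    using that s(3) kd by (simp add: Vk_def mat_of_cols_index)
  define \<tau> where "\<tau> = (\<lambda>i. if i \<le> k then \<sigma> i else 0)"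
  have UD: "U * mat_diag d (\<lambda>i. \<tau> (Suc i)) = mat m d (\<lambda>(a,i). U $$ (a,i) * \<tau> (Suc i))"
    by (rule mat_diag_mult_right[OF s(1)])
  have UDk: "Uk * mat_diag k (\<lambda>i. \<sigma> (Suc i)) = mat m k (\<lambda>(a,i). Uk $$ (a,i) * \<sigma> (Suc i))"
    by (rule mat_diag_mult_right[OF Uk])
  have "Xk = U * mat_diag d (\<lambda>i. \<tau> (Suc i)) * V\<^sup>T"
  proof (rule eq_matI)
    fix a b assume "a < dim_row (U * mat_diag d (\<lambda>i. \<tau> (Suc i)) * V\<^sup>T)"
      "b < dim_col (U * mat_diag d (\<lambda>i. \<tau> (Suc i)) * V\<^sup>T)"
    then have ab: "a < m" "b < n" using s(1,3) by auto
    have "Xk $$ (a,b) = (\<Sum>i<k. Uk $$ (a,i) * \<sigma> (Suc i) * Vk $$ (b,i))"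
      unfolding Xk Uk_def[symmetric] Vk_def[symmetric] UDk using ab Vk
      by (auto simp: scalar_prod_def atLeast0LessThan intro!: sum.cong)
    also have "\<dots> = (\<Sum>i<k. U $$ (a,i) * \<tau> (Suc i) * V $$ (b,i))"
      using ab by (intro sum.cong) (auto simp: Ukij Vkij \<tau>_def)
    also have "\<dots> = (\<Sum>i<d. U $$ (a,i) * \<tau> (Suc i) * V $$ (b,i))"
      using kd by (intro sum.mono_neutral_left) (auto simp: \<tau>_def)
    also have "\<dots> = (U * mat_diag d (\<lambda>i. \<tau> (Suc i)) * V\<^sup>T) $$ (a,b)"
      unfolding UD using ab s(3)
      by (auto simp: scalar_prod_def atLeast0LessThan intro!: sum.cong)
    finally show "Xk $$ (a,b) = (U * mat_diag d (\<lambda>i. \<tau> (Suc i)) * V\<^sup>T) $$ (a,b)" .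
  qed (use s(1,3) in \<open>auto simp: Xk\<close>)
  moreover have "min (dim_row Xk) (dim_col Xk) = d" "dim_row Xk = m" "dim_col Xk = n"
    by (auto simp: Xk d_def)
  ultimately show ?thesis
    unfolding is_svd_def Let_def \<tau>_def using s by (auto simp: d_def)
qed

section \<open>The sample matrix of subspace iteration\<close>

text \<open>
  In the coordinates given by \<open>U\<close>, the matrix \<open>A A\<^sup>T\<close> acts as \<open>\<Sigma>\<^sup>2\<close>. The vector form of this fact
  avoids reassociating long matrix products.
\<close>

lemma svd_gram_power:
  assumes svd: "is_svd A U \<sigma> V" and A: "A \<in> carrier_mat m n" and mn: "n \<le> m"
    and h: "h \<in> carrier_vec n"
  shows "((A * A\<^sup>T) ^\<^sub>m q) *\<^sub>v (U *\<^sub>v h) = U *\<^sub>v vec n (\<lambda>i. \<sigma> (Suc i) ^ (2 * q) * h $ i)"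
  using h
proof (induction q arbitrary: h)
  case 0
  have "vec n (($) h) = h" using 0 by (intro eq_vecI) auto
  then show ?case using is_svdD(1)[OF svd A] A 0 mn by (simp add: min_absorb2)
next
  case (Suc q)
  have d: "min m n = n" "min n m = n" using mn by auto
  note s = is_svdD[OF svd A, unfolded d]
  define D where "D = mat_diag n (\<lambda>i. \<sigma> (Suc i))"
  have AT: "A\<^sup>T \<in> carrier_mat n m" and M: "A * A\<^sup>T \<in> carrier_mat m m" using A by auto
  have Uh: "U *\<^sub>v h \<in> carrier_vec m" using s(1) Suc.prems by simp
  have Dh: "D *\<^sub>v h = vec n (\<lambda>i. \<sigma> (Suc i) * h $ i)"
    unfolding D_def by (rule mat_diag_mult_vec[OF Suc.prems])
  have Dhc: "D *\<^sub>v h \<in> carrier_vec n" unfolding Dh by simp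
  have DDh: "D *\<^sub>v (D *\<^sub>v h) = vec n (\<lambda>i. \<sigma> (Suc i) ^ 2 * h $ i)"
    unfolding D_def mat_diag_mult_vec[OF Dhc[unfolded D_def]]
    by (auto simp: Dh[unfolded D_def] power2_eq_square intro!: eq_vecI)
  have UUh: "U\<^sup>T *\<^sub>v (U *\<^sub>v h) = h"
    using s(1,2) Suc.prems by (subst assoc_mult_mat_vec[symmetric]) auto
  have "A\<^sup>T *\<^sub>v (U *\<^sub>v h) = V *\<^sub>v (D *\<^sub>v h)"
    using svd_mult_vec[OF is_svd_transpose[OF svd] AT Uh] by (simp add: d D_def UUh)
  moreover have "V\<^sup>T *\<^sub>v (V *\<^sub>v (D *\<^sub>v h)) = D *\<^sub>v h"
    using s(3,4) Dhc by (subst assoc_mult_mat_vec[symmetric]) auto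
  ultimately have "A *\<^sub>v (A\<^sup>T *\<^sub>v (U *\<^sub>v h)) = U *\<^sub>v (D *\<^sub>v (D *\<^sub>v h))"
    using svd_mult_vec[OF svd A, of "V *\<^sub>v (D *\<^sub>v h)"] s(3) Dhc by (simp add: d D_def)
  then have step: "(A * A\<^sup>T) *\<^sub>v (U *\<^sub>v h) = U *\<^sub>v vec n (\<lambda>i. \<sigma> (Suc i) ^ 2 * h $ i)"
    unfolding DDh using assoc_mult_mat_vec[OF A AT Uh] by simp
  have "((A * A\<^sup>T) ^\<^sub>m Suc q) *\<^sub>v (U *\<^sub>v h) = ((A * A\<^sup>T) ^\<^sub>m q) *\<^sub>v ((A * A\<^sup>T) *\<^sub>v (U *\<^sub>v h))"
    using assoc_mult_mat_vec[OF pow_carrier_mat[OF M] M Uh] by simp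
  also have "\<dots> = U *\<^sub>v vec n (\<lambda>i. \<sigma> (Suc i) ^ (2 * q) * vec n (\<lambda>i. \<sigma> (Suc i) ^ 2 * h $ i) $ i)"
    unfolding step by (rule Suc.IH) simp
  also have "vec n (\<lambda>i. \<sigma> (Suc i) ^ (2 * q) * vec n (\<lambda>i. \<sigma> (Suc i) ^ 2 * h $ i) $ i) =
      vec n (\<lambda>i. \<sigma> (Suc i) ^ (2 * Suc q) * h $ i)"
    by (auto simp: power2_eq_square intro!: eq_vecI)
  finally show ?case .
qed

lemma iterated_sample_mult_vec:
  assumes svd: "is_svd A U \<sigma> V" and A: "A \<in> carrier_mat m n" and mn: "n \<le> m"
    and \<Omega>: "\<Omega> \<in> carrier_mat n l" and z: "z \<in> carrier_vec l"
  shows "((A * A\<^sup>T) ^\<^sub>m q * A * \<Omega>) *\<^sub>v z =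
    U *\<^sub>v vec n (\<lambda>i. \<sigma> (Suc i) ^ (2 * q + 1) * ((V\<^sup>T * \<Omega>) *\<^sub>v z) $ i)"
proof -
  have d: "min m n = n" using mn by simp
  note s = is_svdD[OF svd A, unfolded d]
  define D where "D = mat_diag n (\<lambda>i. \<sigma> (Suc i))"
  define g where "g = (V\<^sup>T * \<Omega>) *\<^sub>v z"
  have M: "(A * A\<^sup>T) ^\<^sub>m q \<in> carrier_mat m m" using A by (intro pow_carrier_mat) auto
  have MA: "(A * A\<^sup>T) ^\<^sub>m q * A \<in> carrier_mat m n" by (rule mult_carrier_mat[OF M A])
  have VT: "V\<^sup>T \<in> carrier_mat n n" using s(3) by simp
  have \<Omega>z: "\<Omega> *\<^sub>v z \<in> carrier_vec n" using \<Omega> z by simp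
  have g: "g \<in> carrier_vec n" "g = V\<^sup>T *\<^sub>v (\<Omega> *\<^sub>v z)"
    using assoc_mult_mat_vec[OF VT \<Omega> z] VT \<Omega> z \<Omega>z by (auto simp: g_def)
  have "((A * A\<^sup>T) ^\<^sub>m q * A * \<Omega>) *\<^sub>v z = ((A * A\<^sup>T) ^\<^sub>m q) *\<^sub>v (A *\<^sub>v (\<Omega> *\<^sub>v z))"
    using assoc_mult_mat_vec[OF MA \<Omega> z] assoc_mult_mat_vec[OF M A \<Omega>z] by simp
  also have "A *\<^sub>v (\<Omega> *\<^sub>v z) = U *\<^sub>v (D *\<^sub>v g)"
    using svd_mult_vec[OF svd A \<Omega>z] by (simp add: d D_def g)
  also have "D *\<^sub>v g = vec n (\<lambda>i. \<sigma> (Suc i) * g $ i)"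
    unfolding D_def by (rule mat_diag_mult_vec[OF g(1)])
  also have "((A * A\<^sup>T) ^\<^sub>m q) *\<^sub>v (U *\<^sub>v vec n (\<lambda>i. \<sigma> (Suc i) * g $ i)) =
      U *\<^sub>v vec n (\<lambda>i. \<sigma> (Suc i) ^ (2 * q) * vec n (\<lambda>i. \<sigma> (Suc i) * g $ i) $ i)"
    by (rule svd_gram_power[OF svd A mn]) simp
  also have "vec n (\<lambda>i. \<sigma> (Suc i) ^ (2 * q) * vec n (\<lambda>i. \<sigma> (Suc i) * g $ i) $ i) =
      vec n (\<lambda>i. \<sigma> (Suc i) ^ (2 * q + 1) * g $ i)"
    by (auto intro!: eq_vecI)
  finally show ?thesis by (simp add: g_def)
qed

text \<open>
  The scaling of \<open>x\<close> is chosen so that multiplication by \<open>\<Sigma>\<^sup>e\<close> turns the head of \<open>h\<close> into \<open>y\<close> exactly,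
  while the tail \<open>w\<close> is damped by \<open>(\<sigma> (s + 1) / \<sigma> j)\<^sup>e\<close> relative to \<open>y\<close>. The positions from \<open>j\<close> to
  \<open>s - 1\<close> (counted from \<open>0\<close>) are zero, which is where oversampling pays off: the numerator is \<open>\<sigma> (s + 1)\<close> instead of
  \<open>\<sigma> (j + 1)\<close>.
\<close>

lemma amplified_vector_bounds:
  fixes \<sigma> :: "nat \<Rightarrow> real"
  assumes pos: "\<And>i. i \<in> {1..n} \<Longrightarrow> 0 < \<sigma> i"
    and anti: "\<And>i i'. 1 \<le> i \<Longrightarrow> i \<le> i' \<Longrightarrow> i' \<le> n \<Longrightarrow> \<sigma> i' \<le> \<sigma> i"
    and j: "1 \<le> j" "j \<le> s" and s: "s < n"
    and y: "y \<in> carrier_vec j" and w: "w \<in> carrier_vec (n - s)"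
    and x: "x = vec s (\<lambda>i. if i < j then 1 / \<sigma> (Suc i) ^ e * y $ i else 0)"
    and wx: "vec_norm2 w \<le> \<kappa> * vec_norm2 x"
    and h: "h = vec n (\<lambda>i. \<sigma> (Suc i) ^ e * (x @\<^sub>v w) $ i)"
  shows "vec_norm2 y \<le> vec_norm2 h"
    and "vec_norm2 h \<le> sqrt (1 + \<kappa>\<^sup>2 * (\<sigma> (s + 1) / \<sigma> j) ^ (2 * e)) * vec_norm2 y"
    and "\<sigma> j * vec_norm2 y \<le> vec_norm2 (mat_diag n (\<lambda>i. \<sigma> (Suc i)) *\<^sub>v h)"
proof -
  have h_head: "h $ i = y $ i" if "i < j" for i
  proof -
    have "0 < \<sigma> (Suc i)" using that j s by (intro pos) auto
    then show ?thesis using that j s by (simp add: h x)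
  qed
  have sum_head: "(\<Sum>i<j. (y $ i)\<^sup>2) = (vec_norm2 y)\<^sup>2" using y by (simp add: vec_norm2_sq)
  have hc: "h \<in> carrier_vec n" by (simp add: h)
  have \<sigma>j: "0 < \<sigma> j" using j s by (intro pos) auto
  have "(vec_norm2 y)\<^sup>2 = (\<Sum>i<j. (h $ i)\<^sup>2)" using h_head by (simp add: sum_head[symmetric])
  also have "\<dots> \<le> (\<Sum>i<n. (h $ i)\<^sup>2)" using j s by (intro sum_mono2) auto
  also have "\<dots> = (vec_norm2 h)\<^sup>2" using hc by (simp add: vec_norm2_sq)
  finally show "vec_norm2 y \<le> vec_norm2 h" by (rule power2_le_imp_le) simp
  have "(\<sigma> j * vec_norm2 y)\<^sup>2 = (\<Sum>i<j. (\<sigma> j * h $ i)\<^sup>2)"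
    using h_head by (simp add: power_mult_distrib sum_head[symmetric] sum_distrib_left)
  also have "\<dots> \<le> (\<Sum>i<j. (\<sigma> (Suc i) * h $ i)\<^sup>2)"
    using j s \<sigma>j anti by (intro sum_mono) (auto simp: power_mult_distrib intro!: mult_right_mono power_mono)
  also have "\<dots> \<le> (\<Sum>i<n. (\<sigma> (Suc i) * h $ i)\<^sup>2)" using j s by (intro sum_mono2) auto
  also have "\<dots> = (vec_norm2 (mat_diag n (\<lambda>i. \<sigma> (Suc i)) *\<^sub>v h))\<^sup>2"
    unfolding mat_diag_mult_vec[OF hc] by (simp add: vec_norm2_sq)
  finally show "\<sigma> j * vec_norm2 y \<le> vec_norm2 (mat_diag n (\<lambda>i. \<sigma> (Suc i)) *\<^sub>v h)"
    by (rule power2_le_imp_le) simp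
  have norm_x: "(vec_norm2 x)\<^sup>2 \<le> (1 / \<sigma> j ^ e)\<^sup>2 * (vec_norm2 y)\<^sup>2"
  proof -
    have "(vec_norm2 x)\<^sup>2 = (\<Sum>i<s. (if i < j then (1 / \<sigma> (Suc i) ^ e * y $ i)\<^sup>2 else 0))"
      by (auto simp: vec_norm2_sq x intro!: sum.cong)
    also have "\<dots> = (\<Sum>i<j. (1 / \<sigma> (Suc i) ^ e * y $ i)\<^sup>2)"
      using j by (intro sum.mono_neutral_cong_right) auto
    also have "\<dots> \<le> (\<Sum>i<j. (1 / \<sigma> j ^ e * y $ i)\<^sup>2)"
    proof (rule sum_mono)
      fix i assume i: "i \<in> {..<j}"
      have "\<sigma> j \<le> \<sigma> (Suc i)" "0 < \<sigma> (Suc i)" using i j s by (auto intro!: anti pos)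
      then have "1 / \<sigma> (Suc i) ^ e \<le> 1 / \<sigma> j ^ e" "0 \<le> 1 / \<sigma> (Suc i) ^ e"
        using \<sigma>j by (auto intro!: divide_left_mono power_mono)
      then show "(1 / \<sigma> (Suc i) ^ e * y $ i)\<^sup>2 \<le> (1 / \<sigma> j ^ e * y $ i)\<^sup>2"
        unfolding power_mult_distrib by (intro mult_right_mono power_mono) auto
    qed
    also have "\<dots> = (1 / \<sigma> j ^ e)\<^sup>2 * (vec_norm2 y)\<^sup>2"
      by (simp only: power_mult_distrib sum_head[symmetric] sum_distrib_left)
    finally show ?thesis .
  qed
  have "(vec_norm2 h)\<^sup>2 = (\<Sum>i<s. (h $ i)\<^sup>2) + (\<Sum>i<n - s. (h $ (s + i))\<^sup>2)"
  proof -
    have "{..<n} = {..<s} \<union> (\<lambda>i. s + i) ` {..<n - s}"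
    proof (rule Set.set_eqI, rule iffI)
      fix i assume "i \<in> {..<n}"
      then show "i \<in> {..<s} \<union> (\<lambda>i. s + i) ` {..<n - s}"
        by (cases "i < s") (auto intro!: image_eqI[of _ _ "i - s"])
    qed (use s in auto)
    then have "(\<Sum>i<n. (h $ i)\<^sup>2) = (\<Sum>i<s. (h $ i)\<^sup>2) + (\<Sum>i\<in>(\<lambda>i. s + i) ` {..<n - s}. (h $ i)\<^sup>2)"
      by (simp only:) (intro sum.union_disjoint, auto)
    then show ?thesis using hc by (simp add: vec_norm2_sq sum.reindex)
  qed
  also have "(\<Sum>i<s. (h $ i)\<^sup>2) = (vec_norm2 y)\<^sup>2"
  proof -
    have "(\<Sum>i<s. (h $ i)\<^sup>2) = (\<Sum>i<j. (y $ i)\<^sup>2)"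
      using j s h_head by (intro sum.mono_neutral_cong_right) (auto simp: h x)
    then show ?thesis by (simp add: sum_head)
  qed
  also have "(\<Sum>i<n - s. (h $ (s + i))\<^sup>2) \<le> (\<Sum>i<n - s. (\<sigma> (s + 1) ^ e * w $ i)\<^sup>2)"
  proof (rule sum_mono)
    fix i assume i: "i \<in> {..<n - s}"
    have "(x @\<^sub>v w) $ (s + i) = w $ i"
      using i w by (subst index_append_vec(1)) (auto simp: x)
    then have "h $ (s + i) = \<sigma> (Suc (s + i)) ^ e * w $ i" using i by (simp add: h)
    moreover have "\<sigma> (Suc (s + i)) \<le> \<sigma> (s + 1)" "0 < \<sigma> (Suc (s + i))" using i s by (auto intro!: anti pos)
    ultimately show "(h $ (s + i))\<^sup>2 \<le> (\<sigma> (s + 1) ^ e * w $ i)\<^sup>2"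
      by (auto simp: power_mult_distrib intro!: mult_right_mono power_mono)
  qed
  also have "(\<Sum>i<n - s. (\<sigma> (s + 1) ^ e * w $ i)\<^sup>2) = (\<sigma> (s + 1) ^ e)\<^sup>2 * (vec_norm2 w)\<^sup>2"
    using w by (simp add: power_mult_distrib vec_norm2_sq sum_distrib_left)
  also have "\<dots> \<le> (\<sigma> (s + 1) ^ e)\<^sup>2 * (\<kappa>\<^sup>2 * ((1 / \<sigma> j ^ e)\<^sup>2 * (vec_norm2 y)\<^sup>2))"
  proof (rule mult_left_mono)
    have "(vec_norm2 w)\<^sup>2 \<le> \<kappa>\<^sup>2 * (vec_norm2 x)\<^sup>2"
      using power_mono[OF wx, of 2] by (simp add: power_mult_distrib)
    also have "\<dots> \<le> \<kappa>\<^sup>2 * ((1 / \<sigma> j ^ e)\<^sup>2 * (vec_norm2 y)\<^sup>2)" by (intro mult_left_mono norm_x) simp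
    finally show "(vec_norm2 w)\<^sup>2 \<le> \<kappa>\<^sup>2 * ((1 / \<sigma> j ^ e)\<^sup>2 * (vec_norm2 y)\<^sup>2)" .
  qed simp
  also have "(vec_norm2 y)\<^sup>2 + (\<sigma> (s + 1) ^ e)\<^sup>2 * (\<kappa>\<^sup>2 * ((1 / \<sigma> j ^ e)\<^sup>2 * (vec_norm2 y)\<^sup>2)) =
      (1 + \<kappa>\<^sup>2 * (\<sigma> (s + 1) / \<sigma> j) ^ (2 * e)) * (vec_norm2 y)\<^sup>2"
    by (simp add: power_divide algebra_simps flip: power_mult)
  finally have "(vec_norm2 h)\<^sup>2 \<le> (1 + \<kappa>\<^sup>2 * (\<sigma> (s + 1) / \<sigma> j) ^ (2 * e)) * (vec_norm2 y)\<^sup>2" by simp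
  then have "vec_norm2 h \<le> sqrt ((1 + \<kappa>\<^sup>2 * (\<sigma> (s + 1) / \<sigma> j) ^ (2 * e)) * (vec_norm2 y)\<^sup>2)"
    by (rule real_le_rsqrt)
  then show "vec_norm2 h \<le> sqrt (1 + \<kappa>\<^sup>2 * (\<sigma> (s + 1) / \<sigma> j) ^ (2 * e)) * vec_norm2 y"
    by (simp add: real_sqrt_mult)
qed

lemma orthonormal_col_basis_carrier:
  assumes "is_orthonormal_col_basis Q Y" and "Y \<in> carrier_mat m l"
  shows "Q \<in> carrier_mat m (dim_col Q)" "Q\<^sup>T * Q = 1\<^sub>m (dim_col Q)"
    "vec_space.col_space m Q = vec_space.col_space m Y"
  using assms unfolding is_orthonormal_col_basis_def by auto

lemma sample_matrix_carrier:
  assumes A: "A \<in> carrier_mat m n" and \<Omega>: "\<Omega> \<in> carrier_mat n l"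
  shows "(A * A\<^sup>T) ^\<^sub>m q * A * \<Omega> \<in> carrier_mat m l"
proof -
  have "(A * A\<^sup>T) ^\<^sub>m q \<in> carrier_mat m m" using A by (intro pow_carrier_mat) auto
  then show ?thesis by (rule mult_carrier_mat[OF mult_carrier_mat[OF _ A] \<Omega>])
qed

text \<open>\<open>Q Q\<^sup>T\<close> is the identity on the range of \<open>Q\<close>, which contains \<open>Y z\<close>.\<close>

lemma orthonormal_col_basis_project:
  assumes Q: "is_orthonormal_col_basis Q Y" and Y: "Y \<in> carrier_mat m l" and z: "z \<in> carrier_vec l"
  shows "Q *\<^sub>v (Q\<^sup>T *\<^sub>v (Y *\<^sub>v z)) = Y *\<^sub>v z"
proof -
  define r where "r = dim_col Q"
  have Qc: "Q \<in> carrier_mat m r" and QQ: "Q\<^sup>T * Q = 1\<^sub>m r"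
    and cs: "vec_space.col_space m Q = vec_space.col_space m Y"
    unfolding r_def by (rule orthonormal_col_basis_carrier[OF Q Y])+
  have "Y *\<^sub>v z \<in> vec_space.col_space m Q"
    unfolding cs vec_space.col_space_eq[OF Y] using Y z by auto
  then obtain x where x: "x \<in> carrier_vec r" "Y *\<^sub>v z = Q *\<^sub>v x"
    unfolding vec_space.col_space_eq[OF Qc] using Qc by auto
  have "Q\<^sup>T *\<^sub>v (Q *\<^sub>v x) = x"
    using Qc QQ x(1) by (subst assoc_mult_mat_vec[symmetric]) auto
  then show ?thesis using x(2) by simp
qed

section \<open>The two bounds\<close>

text \<open>
  Any right inverse \<open>P\<close> of \<open>\<Omega>1\<close> serves here. The matrix \<open>T\<close> of the proof sends \<open>y\<close> to the coordinates,
  with respect to \<open>Q\<close>, of the vector \<open>U h\<close> of \<open>amplified_vector_bounds\<close>; its injectivity bounds the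
  number of columns of \<open>Q\<close>, and \<open>svd_value_ge_on_subspace\<close> gives the bound on the singular value.
\<close>

lemma subspace_iteration_lower_bound:
  fixes \<sigma> :: "nat \<Rightarrow> real" and P :: "real mat"
  assumes svd: "is_svd A U \<sigma> V" and A: "A \<in> carrier_mat m n" and mn: "n \<le> m"
    and pos: "\<And>i. i \<in> {1..n} \<Longrightarrow> 0 < \<sigma> i"
    and \<Omega>: "\<Omega> \<in> carrier_mat n l" and s: "s < n"
    and \<Omega>1: "\<Omega>1 \<in> carrier_mat s l" and \<Omega>2: "\<Omega>2 \<in> carrier_mat (n - s) l"
    and split: "V\<^sup>T * \<Omega> = \<Omega>1 @\<^sub>r \<Omega>2"
    and P: "P \<in> carrier_mat l s" and \<Omega>P: "\<Omega>1 * P = 1\<^sub>m s"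
    and Q: "is_orthonormal_col_basis Q ((A * A\<^sup>T) ^\<^sub>m q * A * \<Omega>)"
    and svdB: "is_svd (Q\<^sup>T * A) Ub \<tau> Vb"
    and j: "1 \<le> j" "j \<le> s"
  shows "j \<le> dim_col Q" and "\<sigma> j / sqrt (1 + (spectral_norm \<Omega>2 * spectral_norm P)\<^sup>2 *
      (\<sigma> (s + 1) / \<sigma> j) ^ (2 * (2 * q + 1))) \<le> \<tau> j"
proof -
  define e where "e = 2 * q + 1"
  define \<kappa> where "\<kappa> = spectral_norm \<Omega>2 * spectral_norm P"
  define k where k: "k = sqrt (1 + \<kappa>\<^sup>2 * (\<sigma> (s + 1) / \<sigma> j) ^ (2 * e))"
  have d: "min m n = n" "min n m = n" using mn by auto
  note sv = is_svdD[OF svd A, unfolded d]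
  note svT = is_svd_transpose[OF svd]
  have AT: "A\<^sup>T \<in> carrier_mat n m" using A by simp
  define Y where "Y = (A * A\<^sup>T) ^\<^sub>m q * A * \<Omega>"
  have Y: "Y \<in> carrier_mat m l" unfolding Y_def by (rule sample_matrix_carrier[OF A \<Omega>])
  note QY = orthonormal_col_basis_project[OF Q[folded Y_def] Y]
  define r where "r = dim_col Q"
  have Qc: "Q \<in> carrier_mat m r" and QQ: "Q\<^sup>T * Q = 1\<^sub>m r"
    unfolding r_def by (rule orthonormal_col_basis_carrier[OF Q[folded Y_def] Y])+
  have QT: "Q\<^sup>T \<in> carrier_mat r m" using Qc by simp
  define E where "E = mat s j (\<lambda>(i, i'). if i = i' then 1 / \<sigma> (Suc i) ^ e else 0)"
  have E: "E \<in> carrier_mat s j" by (simp add: E_def)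
  have PE: "P * E \<in> carrier_mat l j" using P E by simp
  have QTY: "Q\<^sup>T * Y \<in> carrier_mat r l" using QT Y by simp
  define T where "T = (Q\<^sup>T * Y) * (P * E)"
  have T: "T \<in> carrier_mat r j" unfolding T_def by (rule mult_carrier_mat[OF QTY PE])
  have key: "vec_norm2 y \<le> vec_norm2 (T *\<^sub>v y) \<and> vec_norm2 (T *\<^sub>v y) \<le> k * vec_norm2 y \<and>
      \<sigma> j * vec_norm2 y \<le> vec_norm2 ((Q\<^sup>T * A)\<^sup>T *\<^sub>v (T *\<^sub>v y))"
    if y: "y \<in> carrier_vec j" for y
  proof -
    define x where "x = E *\<^sub>v y"
    define z where "z = P *\<^sub>v x"
    define w where "w = \<Omega>2 *\<^sub>v z"
    define h where "h = vec n (\<lambda>i. \<sigma> (Suc i) ^ e * (x @\<^sub>v w) $ i)"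
    have x: "x = vec s (\<lambda>i. if i < j then 1 / \<sigma> (Suc i) ^ e * y $ i else 0)"
      unfolding x_def E_def by (rule rect_diag_mult_vec[OF y])
    have xc: "x \<in> carrier_vec s" by (simp add: x)
    have zc: "z \<in> carrier_vec l" using P xc by (simp add: z_def)
    have wc: "w \<in> carrier_vec (n - s)" using \<Omega>2 zc by (simp add: w_def)
    have hc: "h \<in> carrier_vec n" by (simp add: h_def)
    have "\<Omega>1 *\<^sub>v z = x"
      unfolding z_def using assoc_mult_mat_vec[OF \<Omega>1 P xc] \<Omega>P xc by simp
    then have "(V\<^sup>T * \<Omega>) *\<^sub>v z = x @\<^sub>v w"
      unfolding split w_def using mat_mult_append[OF \<Omega>1 \<Omega>2 zc] by simp
    then have Yz: "Y *\<^sub>v z = U *\<^sub>v h"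
      unfolding Y_def iterated_sample_mult_vec[OF svd A mn \<Omega> zc] h_def e_def by simp
    have "vec_norm2 w \<le> spectral_norm \<Omega>2 * vec_norm2 z"
      unfolding w_def by (rule vec_norm2_mult_le_spectral[OF \<Omega>2 zc])
    also have "\<dots> \<le> spectral_norm \<Omega>2 * (spectral_norm P * vec_norm2 x)"
      unfolding z_def by (intro mult_left_mono vec_norm2_mult_le_spectral[OF P xc]) simp
    finally have wx: "vec_norm2 w \<le> \<kappa> * vec_norm2 x" by (simp add: \<kappa>_def mult.assoc)
    note bounds = amplified_vector_bounds[OF pos sv(6) j s y wc x wx h_def, folded k]
    have "T *\<^sub>v y = (Q\<^sup>T * Y) *\<^sub>v ((P * E) *\<^sub>v y)"
      unfolding T_def by (rule assoc_mult_mat_vec[OF QTY PE y])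
    also have "(P * E) *\<^sub>v y = z" unfolding z_def x_def by (rule assoc_mult_mat_vec[OF P E y])
    also have "(Q\<^sup>T * Y) *\<^sub>v z = Q\<^sup>T *\<^sub>v (Y *\<^sub>v z)" by (rule assoc_mult_mat_vec[OF QT Y zc])
    finally have Ty: "T *\<^sub>v y = Q\<^sup>T *\<^sub>v (Y *\<^sub>v z)" .
    then have QTy: "Q *\<^sub>v (T *\<^sub>v y) = U *\<^sub>v h" using QY[OF zc] Yz by simp
    have Tyc: "T *\<^sub>v y \<in> carrier_vec r" using T y by simp
    have "vec_norm2 (T *\<^sub>v y) = vec_norm2 (U *\<^sub>v h)"
      using vec_norm2_isometry[OF Qc QQ Tyc] QTy by simp
    also have "\<dots> = vec_norm2 h" by (rule vec_norm2_isometry[OF sv(1,2) hc])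
    finally have nT: "vec_norm2 (T *\<^sub>v y) = vec_norm2 h" .
    have "(Q\<^sup>T * A)\<^sup>T *\<^sub>v (T *\<^sub>v y) = A\<^sup>T *\<^sub>v (U *\<^sub>v h)"
      using transpose_mult[OF QT A] assoc_mult_mat_vec[OF AT Qc Tyc] QTy by simp
    moreover have "U\<^sup>T *\<^sub>v (U *\<^sub>v h) = h"
      using sv(1,2) hc by (subst assoc_mult_mat_vec[symmetric]) auto
    moreover have "U *\<^sub>v h \<in> carrier_vec m" using sv(1) hc by simp
    ultimately have "vec_norm2 ((Q\<^sup>T * A)\<^sup>T *\<^sub>v (T *\<^sub>v y)) = vec_norm2 (mat_diag n (\<lambda>i. \<sigma> (Suc i)) *\<^sub>v h)"
      using svd_norm_mult[OF svT AT] by (simp add: d)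
    then show ?thesis using bounds nT by simp
  qed
  have inj: "y = 0\<^sub>v j" if "y \<in> carrier_vec j" "T *\<^sub>v y = 0\<^sub>v r" for y
  proof (rule ccontr)
    assume "y \<noteq> 0\<^sub>v j"
    then have "0 < vec_norm2 y" by (rule vec_norm2_pos[OF that(1)])
    then show False using key[OF that(1)] that(2) by simp
  qed
  have jr: "j \<le> r"
  proof (rule ccontr)
    assume "\<not> j \<le> r"
    then obtain y where "y \<in> carrier_vec j" "y \<noteq> 0\<^sub>v j" "T *\<^sub>v y = 0\<^sub>v r"
      using underdetermined_nontrivial_kernel[OF T] by auto
    then show False using inj by blast
  qed
  then show "j \<le> dim_col Q" by (simp add: r_def)
  have BT: "(Q\<^sup>T * A)\<^sup>T \<in> carrier_mat n r" using QT A by simp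
  have \<sigma>j: "0 < \<sigma> j" and \<sigma>s: "0 < \<sigma> (s + 1)" using j s by (auto intro!: pos)
  have "1 \<le> k" unfolding k using \<sigma>j \<sigma>s by simp
  then have k0: "0 < k" by simp
  have "\<sigma> j / k \<le> \<tau> j"
  proof (rule svd_value_ge_on_subspace[OF is_svd_transpose[OF svdB] BT T j(1)])
    show "j \<le> min n r" using jr j s by simp
    show "y = 0\<^sub>v j" if "y \<in> carrier_vec j" "T *\<^sub>v y = 0\<^sub>v r" for y using inj[OF that] .
    fix y :: "real vec" assume y: "y \<in> carrier_vec j"
    have "\<sigma> j / k * vec_norm2 (T *\<^sub>v y) \<le> \<sigma> j / k * (k * vec_norm2 y)"
      using key[OF y] \<sigma>j k0 by (intro mult_left_mono) auto
    also have "\<dots> = \<sigma> j * vec_norm2 y" using k0 by simp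
    also have "\<dots> \<le> vec_norm2 ((Q\<^sup>T * A)\<^sup>T *\<^sub>v (T *\<^sub>v y))" using key[OF y] by simp
    finally show "\<sigma> j / k * vec_norm2 (T *\<^sub>v y) \<le> vec_norm2 ((Q\<^sup>T * A)\<^sup>T *\<^sub>v (T *\<^sub>v y))" .
  qed
  then show "\<sigma> j / sqrt (1 + (spectral_norm \<Omega>2 * spectral_norm P)\<^sup>2 *
      (\<sigma> (s + 1) / \<sigma> j) ^ (2 * (2 * q + 1))) \<le> \<tau> j"
    by (simp only: k \<kappa>_def e_def)
qed

theorem theorem4p3:
  fixes A U V \<Omega> \<Omega>1 \<Omega>2 Q Bk :: "real mat" and \<sigma> :: "nat \<Rightarrow> real" and m n k l q p :: nat
  assumes "A \<in> carrier_mat m n" and "m \<ge> n" and "n > max k 2"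
    and "vec_space.rank m A = n"
    and "is_svd A U \<sigma> V"
    and "0 < k" and "k \<le> l" and "l < n" and "p \<le> l - k"
    and "\<Omega> \<in> carrier_mat n l"
    and "\<Omega>1 \<in> carrier_mat (l - p) l" and "\<Omega>2 \<in> carrier_mat (n - l + p) l"
    and "V\<^sup>T * \<Omega> = \<Omega>1 @\<^sub>r \<Omega>2"
    and "vec_space.rank (l - p) \<Omega>1 = l - p"
    and "basic_subspace_iteration A k l q \<Omega> Q Bk"
  shows "\<forall>j\<in>{1..k}.
    \<sigma> j \<ge> singular_value Bk j \<and>
    singular_value Bk j \<ge>
      \<sigma> j / sqrt (1 + (spectral_norm \<Omega>2)\<^sup>2 * (spectral_norm (pseudo_inverse \<Omega>1))\<^sup>2 *
                      (\<sigma> (l - p + 1) / \<sigma> j) ^ (4 * q + 2))"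
proof
  fix j assume j: "j \<in> {1..k}"
  note A = assms(1) and mn = assms(2) and svd = assms(5)
  define s where "s = l - p"
  have s: "k \<le> s" "s < n" "n - l + p = n - s" using assms(6-9) by (auto simp: s_def)
  define r where "r = dim_col Q"
  define B where "B = Q\<^sup>T * A"
  have Q: "is_orthonormal_col_basis Q ((A * A\<^sup>T) ^\<^sub>m q * A * \<Omega>)" and Bk: "is_truncated_svd k B Bk"
    using assms(15) unfolding basic_subspace_iteration_def Let_def B_def by auto
  note Q_cols = orthonormal_col_basis_carrier[OF Q sample_matrix_carrier[OF A assms(10)]]
  have Qc: "Q \<in> carrier_mat m r" and QQ: "Q\<^sup>T * Q = 1\<^sub>m r"
    unfolding r_def by (rule Q_cols)+
  have QT: "Q\<^sup>T \<in> carrier_mat r m" using Qc by simp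
  have B: "B \<in> carrier_mat r n" unfolding B_def by (rule mult_carrier_mat[OF QT A])
  obtain Ub \<tau> Vb where svdB: "is_svd B Ub \<tau> Vb" and
    Bk_eq: "Bk = mat_of_cols (dim_row B) (take k (cols Ub)) *
           mat_diag (min k (min (dim_row B) (dim_col B))) (\<lambda>i. \<tau> (Suc i)) *
           (mat_of_cols (dim_col B) (take k (cols Vb)))\<^sup>T"
    using Bk unfolding is_truncated_svd_def by blast
  have pos: "0 < \<sigma> i" if "i \<in> {1..n}" for i by (rule full_rank_svd_pos[OF svd A mn assms(4) that])
  note P = pseudo_inverse_full_row_rank[OF assms(11,14)]
  note lower = subspace_iteration_lower_bound[OF svd A mn pos assms(10) s(2) assms(11)[folded s_def]
      assms(12)[unfolded s(3)] assms(13) P[folded s_def] Q svdB[unfolded B_def]]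
  have kr: "k \<le> r" unfolding r_def using s assms(6) by (intro lower(1)) auto
  have kd: "k \<le> min r n" using kr assms(3) by simp
  have "is_svd Bk Ub (\<lambda>i. if i \<le> k then \<tau> i else 0) Vb"
    by (rule is_svd_truncated[OF svdB B kd]) (use Bk_eq B kd in \<open>simp add: min_absorb1\<close>)
  moreover have "min (dim_row Bk) (dim_col Bk) = min r n" using B by (simp add: Bk_eq)
  ultimately have sv: "singular_value Bk j = \<tau> j"
    using j kd singular_value_eq[of Bk Ub "\<lambda>i. if i \<le> k then \<tau> i else 0" Vb j] by simp
  have "\<tau> j \<le> \<sigma> j"
  proof (rule svd_value_mono[OF svdB B svd A])
    fix v :: "real vec" assume v: "v \<in> carrier_vec n"
    then have "B *\<^sub>v v = Q\<^sup>T *\<^sub>v (A *\<^sub>v v)" unfolding B_def by (rule assoc_mult_mat_vec[OF QT A])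
    then show "vec_norm2 (B *\<^sub>v v) \<le> vec_norm2 (A *\<^sub>v v)"
      using vec_norm2_coisometry_le[OF Qc QQ, of "A *\<^sub>v v"] A v by simp
  qed (use j kd mn in auto)
  moreover have "\<sigma> j / sqrt (1 + (spectral_norm \<Omega>2)\<^sup>2 * (spectral_norm (pseudo_inverse \<Omega>1))\<^sup>2 *
      (\<sigma> (l - p + 1) / \<sigma> j) ^ (4 * q + 2)) \<le> \<tau> j"
    using lower(2)[of j] j s by (simp add: s_def power_mult_distrib algebra_simps)
  ultimately show "\<sigma> j \<ge> singular_value Bk j \<and>
    singular_value Bk j \<ge>
      \<sigma> j / sqrt (1 + (spectral_norm \<Omega>2)\<^sup>2 * (spectral_norm (pseudo_inverse \<Omega>1))\<^sup>2 *
                      (\<sigma> (l - p + 1) / \<sigma> j) ^ (4 * q + 2))"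
    by (simp add: sv)
qed

end
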